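(* There is a function $f:\mathbb N^3\to\mathbb N$ such that for every prime power $q$ and all conformal matrices $A$ and $B$ over $\mathbb F_q$ (i.e. the number of columns of $A$ equals the number of rows of $B$), the product $AB$ computed over $\mathbb F_q$ has twin-width at most $f(\mathrm{tww}(A),\mathrm{tww}(B),q)$.
   Context: A matrix $M$ over a finite alphabet $A$ with row set $R$ and column set $C$ is identified with the ordered binary structure on $R\uplus C$ with a unary relation for rows, a total order extending the row and column orders with rows before columns, and for each $a\in A$ a binary relation $E_a(r,c)$ holding iff $r\in R$, $c\in C$, $M[r,c]=a$. Twin-width $\mathrm{tww}$: a contraction sequence is a sequence of partitions of the domain from singletons to a single part, each obtained from the previous one by merging two parts; two distinct parts $X,Y$ are red-adjacent if some $u,u'\in X$, $v,v'\in Y$ give pairs $(u,v)$, $(u',v')$ of different atomic types (atomic type: the unary relations containing each element and the binary relations containing $(u,v)$ and $(v,u)$); the twin-width is the least $d$ such that some contraction sequence has, at every step, every part red-adjacent to at most $d$ others. *)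

theory Defs
  imports "Jordan_Normal_Form.Matrix" "HOL-Number_Theory.Prime_Powers"
begin

subsection \<open>Twin-width of binary relational structures\<close>

record ('v, 'p, 'r) binary_structure =
  universe :: "'v set"
  unary_rel :: "'p \<Rightarrow> 'v set"
  binary_rel :: "'r \<Rightarrow> ('v \<times> 'v) set"

definition atomic_type ::
  "('v, 'p, 'r) binary_structure \<Rightarrow> 'v \<Rightarrow> 'v \<Rightarrow> 'p set \<times> 'p set \<times> 'r set \<times> 'r set" where
  "atomic_type S u v =
    ({P. u \<in> unary_rel S P}, {P. v \<in> unary_rel S P},
     {E. (u, v) \<in> binary_rel S E}, {E. (v, u) \<in> binary_rel S E})"

definition red_adjacent :: "('v, 'p, 'r) binary_structure \<Rightarrow> 'v set \<Rightarrow> 'v set \<Rightarrow> bool" where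
  "red_adjacent S X Y \<longleftrightarrow> X \<noteq> Y \<and>
    (\<exists>u\<in>X. \<exists>u'\<in>X. \<exists>v\<in>Y. \<exists>v'\<in>Y. atomic_type S u v \<noteq> atomic_type S u' v')"

definition merges :: "'v set set \<Rightarrow> 'v set set \<Rightarrow> bool" where
  "merges P Q \<longleftrightarrow> (\<exists>X\<in>P. \<exists>Y\<in>P. X \<noteq> Y \<and> Q = insert (X \<union> Y) (P - {X, Y}))"

text \<open>
  The last partition is \<open>{V}\<close> if \<open>V\<close> is nonempty. The inclusion, instead of an equality, also
  admits the one-element sequence consisting of the empty partition if \<open>V\<close> is empty
  (which happens for matrices without rows and columns).
\<close>

definition contraction_sequence :: "'v set \<Rightarrow> 'v set set list \<Rightarrow> bool" where
  "contraction_sequence V Ps \<longleftrightarrow>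
    Ps \<noteq> [] \<and> hd Ps = (\<lambda>v. {v}) ` V \<and> last Ps \<subseteq> {V} \<and> successively merges Ps"

definition twin_width :: "('v, 'p, 'r) binary_structure \<Rightarrow> nat" where
  "twin_width S = (LEAST d. \<exists>Ps. contraction_sequence (universe S) Ps \<and>
    (\<forall>P\<in>set Ps. \<forall>X\<in>P. card {Y \<in> P. red_adjacent S X Y} \<le> d))"

subsection \<open>Matrices as ordered binary structures\<close>

datatype mat_unary = Is_Row

datatype 'a mat_binary = Leq | Entry 'a

text \<open>Row \<open>i\<close> is \<open>Inl i\<close> and column \<open>j\<close> is \<open>Inr j\<close>.\<close>

fun row_col_le :: "nat + nat \<Rightarrow> nat + nat \<Rightarrow> bool" where
  "row_col_le (Inl i) (Inl i') \<longleftrightarrow> i \<le> i'"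
| "row_col_le (Inl i) (Inr j) \<longleftrightarrow> True"
| "row_col_le (Inr j) (Inl i) \<longleftrightarrow> False"
| "row_col_le (Inr j) (Inr j') \<longleftrightarrow> j \<le> j'"

definition row_col_set :: "'a mat \<Rightarrow> (nat + nat) set" where
  "row_col_set M = {..<dim_row M} <+> {..<dim_col M}"

text \<open>
  The relations \<open>Entry a\<close> range over the whole type \<open>'a\<close>. Those for \<open>a\<close> outside the
  alphabet of \<open>M\<close> are empty and have no influence on atomic types, so the alphabet need not be
  a parameter.
\<close>

definition mat_structure ::
  "'a mat \<Rightarrow> (nat + nat, mat_unary, 'a mat_binary) binary_structure" where
  "mat_structure M =
    \<lparr> universe = row_col_set M,
      unary_rel = (\<lambda>Is_Row \<Rightarrow> Inl ` {..<dim_row M}),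
      binary_rel = (\<lambda>
          Leq \<Rightarrow> {(x, y). x \<in> row_col_set M \<and> y \<in> row_col_set M \<and> row_col_le x y}
        | Entry a \<Rightarrow> {(Inl i, Inr j) | i j. i < dim_row M \<and> j < dim_col M \<and> M $$ (i, j) = a}) \<rparr>"

definition tww :: "'a mat \<Rightarrow> nat" where
  "tww M = twin_width (mat_structure M)"

subsection \<open>Matrix product over a ring with explicit carrier\<close>

text \<open>
  The product of the matrix library multiplies with the type class operations of the entry type.
  Here the operations come from a ring record, since a function that does not depend on the field
  can only be quantified outside the fields if these are terms and not types. Every finite field
  has an isomorphic copy on a set of natural numbers, so the records over the type \<open>nat\<close>
  already represent the fields of all prime power orders.
\<close>

definition mat_mult_over :: "('a, 'm) ring_scheme \<Rightarrow> 'a mat \<Rightarrow> 'a mat \<Rightarrow> 'a mat" where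
  "mat_mult_over F A B = mat (dim_row A) (dim_col B)
    (\<lambda>(i, j). finsum F (\<lambda>k. A $$ (i, k) \<otimes>\<^bsub>F\<^esub> B $$ (k, j)) {..<dim_col A})"

end

theory Submission
  imports Defs
begin

text \<open>
  Put the rows of \<open>A\<close>, the common inner indices and the columns of \<open>B\<close> on one line and consider
  divisions of this line into intervals (blocks). A contraction sequence of a matrix bounds, for every
  division into \<open>n\<close> blocks, the total number of disjoint segments of blocks on which a block shows
  many distinct rows by \<open>c * n\<close>: each such pair of a block and a segment is charged to the first
  time one of the two meets few parts. Hence all but a small fraction of the blocks show few
  distinct rows outside few other blocks. This holds for the divisions of both matrices at once, so
  that, starting from singletons, two consecutive blocks can always be merged such that all blocks
  keep this property, although the two given contraction sequences are unrelated.

  A division of this kind is turned into a partition of the rows and columns of \<open>A * B\<close>. Split every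
  block by the types over the cells with few rows and columns, and then by the sums of the entries over the
  classes of inner indices. An entry of the product is determined by the parts of its row and column
  unless both blocks have a complex cell with a common inner block, which happens for boundedly many
  such pairs at each block.
\<close>

subsection \<open>Counting distinct rows\<close>

text \<open>The order enters through one fact: if \<open>x < y < z\<close> and \<open>x\<close>,
  \<open>z\<close> share a part, the order relation alone makes the part of \<open>y\<close> equal
  or red adjacent to it. So the convex hull of a part meets at most twin-width plus one parts, and a
  set enclosed by a part is automatically thin. The counting bound holds for every interval
  division, which frees the merging from the given sequences. It is applied to the division into
  consecutive pairs of blocks: each matrix spoils at most an eighth of the pairs, so some complete
  pair is good for both, and only this pair is merged. The bound for the new block comes afresh from
  the paired division, and all other blocks inherit theirs, so nothing accumulates over the steps.
  Finiteness of the field bounds the refinement by sums: a sum has \<open>q\<close> possible values,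
  and only the boundedly many classes of inner indices in complex cells yield sums that are not
  already determined by the type.\<close>

definition nrows :: "('a \<Rightarrow> 'b \<Rightarrow> 'c) \<Rightarrow> 'a set \<Rightarrow> 'b set \<Rightarrow> nat" where
  "nrows f U W = card ((\<lambda>u. restrict (f u) W) ` U)"

lemma nrows_mono:
  assumes "finite U" "U' \<subseteq> U" "W' \<subseteq> W"
  shows "nrows f U' W' \<le> nrows f U W"
proof -
  have "(\<lambda>u. restrict (f u) W') ` U' \<subseteq> (\<lambda>r. restrict r W') ` (\<lambda>u. restrict (f u) W) ` U"
    using assms by (auto simp: image_image Int_absorb1 intro!: image_eqI)
  then show ?thesis
    unfolding nrows_def using assms(1)
    by (meson card_image_le card_mono finite_imageI le_trans)
qed

lemma nrows_le_card: "finite U \<Longrightarrow> nrows f U W \<le> card U"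
  unfolding nrows_def by (rule card_image_le)

lemma card_image_le_if_determined:
  assumes "finite (g ` U)" "\<And>u v. u \<in> U \<Longrightarrow> v \<in> U \<Longrightarrow> g u = g v \<Longrightarrow> h u = h v"
  shows "card (h ` U) \<le> card (g ` U)"
proof -
  have "h ` U \<subseteq> (\<lambda>y. h (SOME u. u \<in> U \<and> g u = y)) ` g ` U"
  proof
    fix z assume "z \<in> h ` U"
    then obtain u where u: "u \<in> U" "z = h u" by blast
    let ?v = "SOME v. v \<in> U \<and> g v = g u"
    have "?v \<in> U \<and> g ?v = g u" by (rule someI) (use u in simp)
    then have "h ?v = h u" using assms(2) u by blast
    then show "z \<in> (\<lambda>y. h (SOME u. u \<in> U \<and> g u = y)) ` g ` U" using u by (auto intro!: image_eqI)
  qed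
  then show ?thesis by (meson assms(1) card_image_le card_mono finite_imageI le_trans)
qed

lemma nrows_le_if_determined:
  assumes "finite (g ` U)"
    "\<And>u v w. u \<in> U \<Longrightarrow> v \<in> U \<Longrightarrow> w \<in> W \<Longrightarrow> g u = g v \<Longrightarrow> f u w = f v w"
  shows "nrows f U W \<le> card (g ` U)"
  unfolding nrows_def
proof (rule card_image_le_if_determined[OF assms(1)])
  fix u v assume "u \<in> U" "v \<in> U" "g u = g v"
  then show "restrict (f u) W = restrict (f v) W" by (intro restrict_ext assms(2))
qed

text \<open>A row depends only on the class \<open>g w\<close> of its argument, so it is a map from
  at most \<open>k\<close> classes to \<open>Q\<close>. This is how few distinct columns become few
  distinct rows.\<close>

lemma nrows_le_power:
  assumes "finite W" "finite Q" "\<And>u w. u \<in> U \<Longrightarrow> w \<in> W \<Longrightarrow> f u w \<in> Q" "Q \<noteq> {}"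
    "finite (g ` W)" "card (g ` W) \<le> k"
    "\<And>u w w'. u \<in> U \<Longrightarrow> w \<in> W \<Longrightarrow> w' \<in> W \<Longrightarrow> g w = g w' \<Longrightarrow> f u w = f u w'"
  shows "nrows f U W \<le> card Q ^ k"
proof -
  define r where "r y = (SOME w. w \<in> W \<and> g w = y)" for y
  have r: "r (g w) \<in> W \<and> g (r (g w)) = g w" if "w \<in> W" for w
    unfolding r_def by (rule someI[of _ w]) (use that in simp)
  define F where "F u = (\<lambda>y\<in>g ` W. f u (r y))" for u
  have sub: "F ` U \<subseteq> g ` W \<rightarrow>\<^sub>E Q" using assms(3) r by (auto simp: F_def)
  have fin: "finite (g ` W \<rightarrow>\<^sub>E Q)" by (intro finite_PiE assms(2,5))
  have "nrows f U W \<le> card (F ` U)"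
  proof (rule nrows_le_if_determined)
    show "finite (F ` U)" using sub fin finite_subset by blast
    fix u v w assume *: "u \<in> U" "v \<in> U" "w \<in> W" "F u = F v"
    have "f u (r (g w)) = f v (r (g w))"
      using fun_cong[OF *(4), of "g w"] *(3) by (simp add: F_def)
    then show "f u w = f v w" using assms(7) r * by metis
  qed
  also have "\<dots> \<le> card (g ` W \<rightarrow>\<^sub>E Q)" using sub fin card_mono by blast
  also have "\<dots> = card Q ^ card (g ` W)" by (simp add: card_PiE[OF assms(5)])
  also have "\<dots> \<le> card Q ^ k"
    using assms(2,4,6) by (intro power_increasing) (auto simp: Suc_le_eq card_gt_0_iff)
  finally show ?thesis .
qed

lemma card_Sigma_le:
  assumes "finite A" "\<And>a. a \<in> A \<Longrightarrow> finite (B a)" "\<And>a. a \<in> A \<Longrightarrow> card (B a) \<le> k"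
  shows "card (Sigma A B) \<le> card A * k"
proof -
  have "card (Sigma A B) = (\<Sum>a\<in>A. card (B a))" using assms by (intro card_SigmaI) auto
  also have "\<dots> \<le> card A * k" using sum_bounded_above[of A "\<lambda>a. card (B a)" k] assms by simp
  finally show ?thesis .
qed

lemma card_UN_le_mult:
  assumes "finite A" "\<And>a. a \<in> A \<Longrightarrow> card (B a) \<le> k"
  shows "card (\<Union>a\<in>A. B a) \<le> card A * k"
proof -
  have "card (\<Union>a\<in>A. B a) \<le> (\<Sum>a\<in>A. card (B a))" by (rule card_UN_le[OF assms(1)])
  also have "\<dots> \<le> card A * k" using sum_bounded_above[of A "\<lambda>a. card (B a)" k] assms by simp
  finally show ?thesis .
qed

lemma obtain_three_increasing:
  fixes A :: "nat set"
  assumes "finite A" "card A > 2"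
  obtains i j k where "i \<in> A" "j \<in> A" "k \<in> A" "i < j" "j < k"
proof -
  have ne: "A \<noteq> {}" using assms by auto
  have "\<not> A \<subseteq> {Min A, Max A}"
  proof
    assume "A \<subseteq> {Min A, Max A}"
    then have "card A \<le> card {Min A, Max A}" by (rule card_mono[rotated]) simp
    also have "\<dots> \<le> 2" by (simp add: card_insert_if)
    finally show False using assms by simp
  qed
  then obtain j where "j \<in> A" "j \<noteq> Min A" "j \<noteq> Max A" by blast
  then show ?thesis using that[of "Min A" j "Max A"] assms ne
    by (metis Max_ge Max_in Min_in Min_le le_neq_implies_less)
qed

subsection \<open>Charging complex cells to a contraction sequence\<close>

text \<open>\<open>lab t v\<close> is the part of \<open>v\<close> at time \<open>t\<close>, and \<open>near\<close> is equality or red adjacency of parts.\<close>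

locale contraction_labelling =
  fixes V :: "nat set" and T D :: nat
    and lab :: "nat \<Rightarrow> nat \<Rightarrow> 'l"
    and near :: "nat \<Rightarrow> 'l \<Rightarrow> 'l \<Rightarrow> bool"
    and f :: "nat \<Rightarrow> nat \<Rightarrow> 'c"
  assumes finite_V: "finite V"
    and D_pos: "0 < D"
    and near_sym: "near t k l \<Longrightarrow> near t l k"
    and card_near: "t \<le> T \<Longrightarrow> v \<in> V \<Longrightarrow> card {l \<in> lab t ` V. near t (lab t v) l} \<le> D"
    and near_between: "t \<le> T \<Longrightarrow> x \<in> V \<Longrightarrow> y \<in> V \<Longrightarrow> z \<in> V \<Longrightarrow> x \<le> y \<Longrightarrow> y \<le> z \<Longrightarrow>
      lab t x = lab t z \<Longrightarrow> near t (lab t x) (lab t y)"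
    and homogeneous: "t \<le> T \<Longrightarrow> u \<in> V \<Longrightarrow> u' \<in> V \<Longrightarrow> v \<in> V \<Longrightarrow> v' \<in> V \<Longrightarrow>
      lab t u = lab t u' \<Longrightarrow> lab t v = lab t v' \<Longrightarrow> \<not> near t (lab t u) (lab t v) \<Longrightarrow>
      f u v = f u' v'"
    and step: "t < T \<Longrightarrow> \<exists>x\<in>V. \<exists>y\<in>V. lab t x \<noteq> lab t y \<and>
      (\<forall>u\<in>V. \<forall>v\<in>V. lab (Suc t) u = lab (Suc t) v \<longleftrightarrow>
        lab t u = lab t v \<or> {lab t u, lab t v} = {lab t x, lab t y})"
    and init: "inj_on (lab 0) V"
    and final: "u \<in> V \<Longrightarrow> v \<in> V \<Longrightarrow> lab T u = lab T v"
begin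

text \<open>The threshold equals the bound on near parts, so that a set whose parts are all near one
  single part is thin.\<close>

definition thin :: "nat \<Rightarrow> nat set \<Rightarrow> bool" where
  "thin t U \<longleftrightarrow> card (lab t ` U) \<le> D"

definition nbs :: "nat \<Rightarrow> nat set \<Rightarrow> 'l set" where
  "nbs t U = {l \<in> lab t ` V. \<exists>u\<in>U. near t (lab t u) l}"

definition first_thin :: "nat set \<Rightarrow> nat" where
  "first_thin U = (LEAST t. thin t U)"

lemma finite_sub: "U \<subseteq> V \<Longrightarrow> finite U"
  using finite_V finite_subset by blast

lemma finite_nbs: "finite (nbs t U)"
  unfolding nbs_def using finite_V by auto

lemma thin_subset:
  assumes "thin t U" "U' \<subseteq> U" "U \<subseteq> V"
  shows "thin t U'"
proof -
  have "card (lab t ` U') \<le> card (lab t ` U)"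
    using assms finite_sub by (intro card_mono image_mono) auto
  then show ?thesis using assms(1) unfolding thin_def by linarith
qed

lemma thin_if_near_all:
  assumes "t \<le> T" "v \<in> V" "U \<subseteq> V" "\<And>u. u \<in> U \<Longrightarrow> near t (lab t v) (lab t u)"
  shows "thin t U"
proof -
  have "lab t ` U \<subseteq> {l \<in> lab t ` V. near t (lab t v) l}" using assms by auto
  then have "card (lab t ` U) \<le> card {l \<in> lab t ` V. near t (lab t v) l}"
    using finite_V by (intro card_mono) auto
  then show ?thesis using card_near[OF assms(1,2)] unfolding thin_def by linarith
qed

text \<open>All parts met between two elements of one part are near that part, so there are at most
  \<open>D\<close> of them.\<close>

lemma thin_if_between:
  assumes "t \<le> T" "x \<in> V" "z \<in> V" "lab t x = lab t z" "U \<subseteq> V"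
    "\<And>u. u \<in> U \<Longrightarrow> x \<le> u \<and> u \<le> z"
  shows "thin t U"
  using thin_if_near_all[OF assms(1,2,5)] near_between[OF assms(1,2) _ assms(3)] assms(4-6) by blast

text \<open>A merge only identifies labels, so the number of labels on a set never grows.\<close>

lemma thin_Suc:
  assumes "thin t U" "U \<subseteq> V" "t < T"
  shows "thin (Suc t) U"
proof -
  have "lab (Suc t) u = lab (Suc t) v" if "u \<in> U" "v \<in> U" "lab t u = lab t v" for u v
    using step[OF assms(3)] that assms(2) by blast
  then have "card (lab (Suc t) ` U) \<le> card (lab t ` U)"
    using finite_sub[OF assms(2)] by (intro card_image_le_if_determined finite_imageI)
  then show ?thesis using assms(1) unfolding thin_def by linarith
qed

lemma thin_mono:
  assumes "thin t U" "U \<subseteq> V" "t \<le> t'" "t' \<le> T"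
  shows "thin t' U"
  using assms(3,4)
proof (induction t' rule: dec_induct)
  case base show ?case by (rule assms(1))
next
  case (step n) then show ?case using thin_Suc[of n U] assms(2) by simp
qed

lemma thin_final: "U \<subseteq> V \<Longrightarrow> thin T U"
proof -
  assume U: "U \<subseteq> V"
  show ?thesis
  proof (cases "U = {}")
    case False
    then obtain v where "v \<in> U" by blast
    then have "lab T ` U = {lab T v}" using final U by blast
    then show ?thesis using D_pos unfolding thin_def by simp
  qed (simp add: thin_def)
qed

lemma thin_iff_first_thin:
  assumes "U \<subseteq> V" "t \<le> T"
  shows "thin t U \<longleftrightarrow> first_thin U \<le> t"
proof
  show "thin t U \<Longrightarrow> first_thin U \<le> t" unfolding first_thin_def by (rule Least_le)
  have "thin (first_thin U) U" unfolding first_thin_def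
    by (rule LeastI[of "\<lambda>t. thin t U", OF thin_final[OF assms(1)]])
  then show "first_thin U \<le> t \<Longrightarrow> thin t U" using thin_mono assms by blast
qed

lemma first_thin_le: "U \<subseteq> V \<Longrightarrow> first_thin U \<le> T"
  using thin_iff_first_thin[of U T] thin_final by simp

lemma card_nbs_le:
  assumes "t \<le> T" "U \<subseteq> V"
  shows "card (nbs t U) \<le> card (lab t ` U) * D"
proof -
  have "nbs t U = (\<Union>k\<in>lab t ` U. {l \<in> lab t ` V. near t k l})"
    unfolding nbs_def by auto
  also have "card \<dots> \<le> card (lab t ` U) * D"
    using assms card_near finite_sub by (intro card_UN_le_mult) auto
  finally show ?thesis .
qed

lemma nrows_le_if_not_near:
  assumes "t \<le> T" "U \<subseteq> V" "W \<subseteq> V"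
    "\<And>u w. u \<in> U \<Longrightarrow> w \<in> W \<Longrightarrow> \<not> near t (lab t u) (lab t w)"
  shows "nrows f U W \<le> card (lab t ` U)"
proof (rule nrows_le_if_determined)
  show "finite (lab t ` U)" using assms finite_sub by auto
  fix u v w assume "u \<in> U" "v \<in> U" "w \<in> W" "lab t u = lab t v"
  then show "f u w = f v w" using homogeneous[OF assms(1), of u v w w] assms by blast
qed

text \<open>A label seen in three members of an ordered family encloses the middle one, which is
  then thin.\<close>

lemma card_nonthin_meeting_label:
  assumes "t \<le> T" "finite A" "\<And>i. i \<in> A \<Longrightarrow> G i \<subseteq> V" "\<And>i. i \<in> A \<Longrightarrow> \<not> thin t (G i)"
    "\<And>i j x y. i \<in> A \<Longrightarrow> j \<in> A \<Longrightarrow> i < j \<Longrightarrow> x \<in> G i \<Longrightarrow> y \<in> G j \<Longrightarrow> x \<le> y"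
    "\<And>i. i \<in> A \<Longrightarrow> l \<in> lab t ` G i"
  shows "card (A :: nat set) \<le> 2"
proof (rule ccontr)
  assume "\<not> card A \<le> 2"
  then obtain i j k where ijk: "i \<in> A" "j \<in> A" "k \<in> A" "i < j" "j < k"
    using obtain_three_increasing[OF assms(2)] by auto
  obtain x z where xz: "x \<in> G i" "lab t x = l" "z \<in> G k" "lab t z = l"
    using assms(6)[OF ijk(1)] assms(6)[OF ijk(3)] by auto
  have "thin t (G j)"
  proof (rule thin_if_between[of t x z])
    show "x \<in> V" "z \<in> V" using xz ijk assms(3) by blast+
    show "lab t x = lab t z" using xz by simp
    show "x \<le> u \<and> u \<le> z" if "u \<in> G j" for u
      using assms(5)[OF ijk(1,2,4) xz(1) that] assms(5)[OF ijk(2,3,5) that xz(3)] by simp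
  qed (use assms(1,3) ijk in auto)
  then show False using assms(4) ijk by blast
qed

lemma card_nonthin_meeting_labels:
  assumes "t \<le> T" "finite A" "\<And>i. i \<in> A \<Longrightarrow> G i \<subseteq> V" "\<And>i. i \<in> A \<Longrightarrow> \<not> thin t (G i)"
    "\<And>i j x y. i \<in> A \<Longrightarrow> j \<in> A \<Longrightarrow> i < j \<Longrightarrow> x \<in> G i \<Longrightarrow> y \<in> G j \<Longrightarrow> x \<le> y"
    "\<And>i. i \<in> A \<Longrightarrow> lab t ` G i \<inter> N \<noteq> {}" "finite N"
  shows "card (A :: nat set) \<le> card N * 2"
proof -
  have "A \<subseteq> (\<Union>l\<in>N. {i \<in> A. l \<in> lab t ` G i})" using assms(6) by fastforce
  then have "card A \<le> card (\<Union>l\<in>N. {i \<in> A. l \<in> lab t ` G i})"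
    using assms(2,7) by (intro card_mono) auto
  also have "\<dots> \<le> card N * 2"
    using assms(7)
  proof (rule card_UN_le_mult)
    fix l
    show "card {i \<in> A. l \<in> lab t ` G i} \<le> 2"
      by (rule card_nonthin_meeting_label[of t _ G l]) (use assms in auto)
  qed
  finally show ?thesis .
qed

section \<open>The pair merged in a step and the leaders it removes\<close>

definition merged :: "nat \<Rightarrow> nat \<times> nat" where
  "merged t = (SOME p. fst p \<in> V \<and> snd p \<in> V \<and> lab t (fst p) \<noteq> lab t (snd p) \<and>
    (\<forall>u\<in>V. \<forall>v\<in>V. lab (Suc t) u = lab (Suc t) v \<longleftrightarrow>
      lab t u = lab t v \<or> {lab t u, lab t v} = {lab t (fst p), lab t (snd p)}))"

definition merged1 :: "nat \<Rightarrow> 'l" where "merged1 t = lab t (fst (merged t))"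
definition merged2 :: "nat \<Rightarrow> 'l" where "merged2 t = lab t (snd (merged t))"

lemma merged:
  assumes "t < T"
  shows "merged1 t \<in> lab t ` V" "merged2 t \<in> lab t ` V" "merged1 t \<noteq> merged2 t"
    "\<And>u v. u \<in> V \<Longrightarrow> v \<in> V \<Longrightarrow> lab (Suc t) u = lab (Suc t) v \<longleftrightarrow>
      lab t u = lab t v \<or> {lab t u, lab t v} = {merged1 t, merged2 t}"
proof -
  have "\<exists>p. fst p \<in> V \<and> snd p \<in> V \<and> lab t (fst p) \<noteq> lab t (snd p) \<and>
    (\<forall>u\<in>V. \<forall>v\<in>V. lab (Suc t) u = lab (Suc t) v \<longleftrightarrow>
      lab t u = lab t v \<or> {lab t u, lab t v} = {lab t (fst p), lab t (snd p)})"
  proof -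
    obtain x y where "x \<in> V" "y \<in> V" "lab t x \<noteq> lab t y"
      "\<forall>u\<in>V. \<forall>v\<in>V. lab (Suc t) u = lab (Suc t) v \<longleftrightarrow>
        lab t u = lab t v \<or> {lab t u, lab t v} = {lab t x, lab t y}"
      using step[OF assms] by (elim bexE conjE)
    then show ?thesis by (intro exI[of _ "(x, y)"]) simp
  qed
  from someI_ex[OF this, folded merged_def]
  have *: "fst (merged t) \<in> V \<and> snd (merged t) \<in> V \<and> merged1 t \<noteq> merged2 t \<and>
    (\<forall>u\<in>V. \<forall>v\<in>V. lab (Suc t) u = lab (Suc t) v \<longleftrightarrow>
      lab t u = lab t v \<or> {lab t u, lab t v} = {merged1 t, merged2 t})"
    unfolding merged1_def merged2_def .
  show "merged1 t \<in> lab t ` V" unfolding merged1_def using *[THEN conjunct1] by (rule imageI)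
  show "merged2 t \<in> lab t ` V"
    unfolding merged2_def using *[THEN conjunct2, THEN conjunct1] by (rule imageI)
  show "merged1 t \<noteq> merged2 t" using *[THEN conjunct2, THEN conjunct2, THEN conjunct1] .
  show "lab (Suc t) u = lab (Suc t) v \<longleftrightarrow>
      lab t u = lab t v \<or> {lab t u, lab t v} = {merged1 t, merged2 t}"
    if "u \<in> V" "v \<in> V" for u v
    by (rule *[THEN conjunct2, THEN conjunct2, THEN conjunct2, THEN bspec, OF that(1),
        THEN bspec, OF that(2)])
qed

text \<open>If \<open>U\<close> misses one of the two merged parts, the merge identifies no two
  labels on \<open>U\<close>, and their number cannot drop to \<open>D\<close>.\<close>

lemma newly_thin_meets_merged:
  assumes "t < T" "U \<subseteq> V" "\<not> thin t U" "thin (Suc t) U"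
  shows "merged1 t \<in> lab t ` U" "merged2 t \<in> lab t ` U"
proof -
  have "merged1 t \<in> lab t ` U \<and> merged2 t \<in> lab t ` U"
  proof (rule ccontr)
    assume *: "\<not> (merged1 t \<in> lab t ` U \<and> merged2 t \<in> lab t ` U)"
    have "card (lab t ` U) \<le> card (lab (Suc t) ` U)"
    proof (rule card_image_le_if_determined)
      show "finite (lab (Suc t) ` U)" using finite_sub[OF assms(2)] by simp
      fix u v assume uv: "u \<in> U" "v \<in> U" "lab (Suc t) u = lab (Suc t) v"
      then have "lab t u = lab t v \<or> {lab t u, lab t v} = {merged1 t, merged2 t}"
        using merged(4)[OF assms(1), of u v] assms(2) by auto
      then show "lab t u = lab t v" using * uv(1,2) by (metis doubleton_eq_iff imageI)
    qed
    then show False using assms(3,4) unfolding thin_def by simp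
  qed
  then show "merged1 t \<in> lab t ` U" "merged2 t \<in> lab t ` U" by auto
qed

text \<open>
  With \<open>key\<close> the identity or the negation, leaders are the minima or maxima of the parts. Each merge
  removes exactly one leader, and a thin block contains at most \<open>D\<close> of them, so few merges remove a
  leader from a block that is already thin.
\<close>

definition leads :: "(nat \<Rightarrow> int) \<Rightarrow> nat \<Rightarrow> nat \<Rightarrow> bool" where
  "leads key t v \<longleftrightarrow> v \<in> V \<and> (\<forall>u\<in>V. lab t u = lab t v \<longrightarrow> key v \<le> key u)"

text \<open>The last conjunct places an element of each merged part on the far side of
  \<open>v\<close>. It allows a lost minimum and a lost maximum to be replaced by two elements of
  one common part.\<close>

definition loses_lead :: "(nat \<Rightarrow> int) \<Rightarrow> nat \<Rightarrow> nat \<Rightarrow> bool" where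
  "loses_lead key t v \<longleftrightarrow> leads key t v \<and> \<not> leads key (Suc t) v \<and>
    lab t v \<in> {merged1 t, merged2 t} \<and>
    (\<forall>l\<in>{merged1 t, merged2 t}. \<exists>w\<in>V. lab t w = l \<and> key w \<le> key v)"

text \<open>Parts only grow, so an extreme element of the later part is extreme in the earlier one.
  A lost lead is therefore never regained.\<close>

lemma leads_antimono:
  assumes "leads key t' v" "t \<le> t'" "t' \<le> T"
  shows "leads key t v"
  using assms(2,1,3)
proof (induction t' rule: dec_induct)
  case (step m)
  have v: "v \<in> V" using step.prems unfolding leads_def by blast
  have "lab (Suc m) u = lab (Suc m) v" if "u \<in> V" "lab m u = lab m v" for u
    using merged(4)[OF _ that(1) v] that(2) step.prems(2) by simp
  then have "leads key m v" using step.prems(1) v unfolding leads_def by blast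
  then show ?case using step by simp
qed

lemma ex_leads:
  assumes "l \<in> lab t ` V"
  obtains v where "leads key t v" "lab t v = l"
proof -
  let ?S = "{v \<in> V. lab t v = l}"
  have fin: "finite (key ` ?S)" "key ` ?S \<noteq> {}" using finite_V assms by auto
  then obtain v where v: "v \<in> ?S" "key v = Min (key ` ?S)"
    using Min_in[OF fin] by (metis (no_types, lifting) imageE)
  have "key v \<le> key u" if "u \<in> ?S" for u using v Min_le[OF fin(1)] that by auto
  then show ?thesis using that[of v] v unfolding leads_def by auto
qed

text \<open>Of the leaders of the two merged parts, the one with the larger key stops leading; the
  other one witnesses the last conjunct for its part.\<close>

lemma ex_loses_lead:
  assumes "t < T" "inj key"
  shows "\<exists>v. loses_lead key t v"
proof -
  obtain v w where v: "leads key t v" "lab t v = merged1 t"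
    and w: "leads key t w" "lab t w = merged2 t"
    using ex_leads merged(1,2)[OF assms(1)] by metis
  have "v \<noteq> w" using v w merged(3)[OF assms(1)] by metis
  then have ne: "key v \<noteq> key w" using assms(2) by (simp add: inj_eq)
  have vw: "v \<in> V" "w \<in> V" using v w by (auto simp: leads_def)
  have eq: "lab (Suc t) v = lab (Suc t) w" using merged(4)[OF assms(1) vw] v w by auto
  show ?thesis
  proof (cases "key v < key w")
    case True
    then have "\<not> leads key (Suc t) w" using vw eq unfolding leads_def by force
    moreover have "\<exists>u\<in>V. lab t u = l \<and> key u \<le> key w" if "l \<in> {merged1 t, merged2 t}" for l
      using that True v w vw by (metis empty_iff insert_iff less_imp_le order_refl)
    ultimately have "loses_lead key t w" using w unfolding loses_lead_def by auto
    then show ?thesis ..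
  next
    case False
    then have less: "key w < key v" using ne by simp
    then have "\<not> leads key (Suc t) v" using vw eq unfolding leads_def by force
    moreover have "\<exists>u\<in>V. lab t u = l \<and> key u \<le> key v" if "l \<in> {merged1 t, merged2 t}" for l
      using that less v w vw by (metis empty_iff insert_iff less_imp_le order_refl)
    ultimately have "loses_lead key t v" using v unfolding loses_lead_def by auto
    then show ?thesis ..
  qed
qed

text \<open>The losers are distinct, and every loser after the first time in \<open>S\<close> still
  leads right after that time. There \<open>U\<close> is thin, and leaders have different labels, so
  at most \<open>D\<close> of them lie in \<open>U\<close>. The \<open>Suc\<close> counts the first
  time itself.\<close>

lemma card_loses_lead_le:
  assumes "inj key" "S \<subseteq> {..<T}" "U \<subseteq> V" "\<And>t. t \<in> S \<Longrightarrow> thin (Suc t) U"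
    "\<And>t. t \<in> S \<Longrightarrow> m t \<in> U" "\<And>t. t \<in> S \<Longrightarrow> loses_lead key t (m t)"
  shows "card S \<le> Suc D"
proof (cases "S = {}")
  case False
  have fin: "finite S" using assms(2) finite_subset by blast
  define t1 where "t1 = Min S"
  have t1: "t1 \<in> S" "\<And>t. t \<in> S \<Longrightarrow> t1 \<le> t" unfolding t1_def using fin False by auto
  have later: "leads key (Suc t) (m t')" if "t \<in> S" "t' \<in> S" "t < t'" for t t'
    using leads_antimono[of key t' "m t'" "Suc t"] assms(2,6) that
    by (auto simp: loses_lead_def)
  have "inj_on m S"
  proof (rule linorder_inj_onI)
    fix t t' assume "t < t'" "t \<in> S" "t' \<in> S"
    then show "m t \<noteq> m t'" using later[of t t'] assms(6)[of t] by (auto simp: loses_lead_def)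
  qed auto
  then have inj: "inj_on m (S - {t1})" by (rule inj_on_subset) auto
  let ?L = "{v \<in> U. leads key (Suc t1) v}"
  have finU: "finite U" using finite_sub[OF assms(3)] .
  have sub: "m ` (S - {t1}) \<subseteq> ?L"
  proof
    fix v assume "v \<in> m ` (S - {t1})"
    then obtain t where t: "t \<in> S" "t \<noteq> t1" "v = m t" by blast
    then have "t1 < t" using t1(2)[of t] by simp
    then show "v \<in> ?L" using later[OF t1(1) t(1)] t assms(5) by auto
  qed
  have "inj_on (lab (Suc t1)) ?L"
  proof (rule inj_onI)
    fix u v assume *: "u \<in> ?L" "v \<in> ?L" "lab (Suc t1) u = lab (Suc t1) v"
    then have "key u = key v" unfolding leads_def by (auto intro: antisym)
    then show "u = v" using assms(1) by (simp add: inj_eq)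
  qed
  then have "card ?L = card (lab (Suc t1) ` ?L)" by (simp add: card_image)
  also have "\<dots> \<le> card (lab (Suc t1) ` U)" using finU by (intro card_mono) auto
  also have "\<dots> \<le> D" using assms(4)[OF t1(1)] by (simp add: thin_def)
  finally have "card (S - {t1}) \<le> D"
    using card_mono[OF _ sub] finU card_image[OF inj] by simp
  then show ?thesis using fin t1(1) by (simp add: card_Diff_singleton)
qed simp

section \<open>Segments of consecutive blocks and the steps at which they become thin\<close>

definition seg :: "(nat \<Rightarrow> nat) \<Rightarrow> nat \<Rightarrow> nat \<Rightarrow> nat set" where
  "seg b s e = {v \<in> V. s \<le> b v \<and> b v \<le> e}"

lemma seg_subset: "seg b s e \<subseteq> V"
  by (auto simp: seg_def)

definition newly_thin :: "(nat \<Rightarrow> nat) \<Rightarrow> nat \<Rightarrow> nat \<Rightarrow> nat \<Rightarrow> bool" where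
  "newly_thin b t s e \<longleftrightarrow> \<not> thin t (seg b s e) \<and> thin (Suc t) (seg b s e)"

text \<open>Otherwise the minimum and the maximum of a merged part lie on both sides of the segment, which
  then was thin before.\<close>

lemma lost_lead_in_thin_block:
  assumes "t < T" "mono_on V b" "newly_thin b t s e"
    "loses_lead int t m" "loses_lead (\<lambda>v. - int v) t M"
  shows "thin (Suc t) (seg b (b m) (b m)) \<or> thin (Suc t) (seg b (b M) (b M))"
proof (rule ccontr)
  assume "\<not> ?thesis"
  then have nt: "\<not> thin (Suc t) (seg b (b m) (b m))" "\<not> thin (Suc t) (seg b (b M) (b M))" by auto
  have new: "\<not> thin t (seg b s e)" "thin (Suc t) (seg b s e)"
    using assms(3) unfolding newly_thin_def by auto
  note meets = newly_thin_meets_merged[OF assms(1) seg_subset new]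
  have out: "\<not> (s \<le> b v \<and> b v \<le> e)" if "\<not> thin (Suc t) (seg b (b v) (b v))" for v
  proof
    assume "s \<le> b v \<and> b v \<le> e"
    then have "seg b (b v) (b v) \<subseteq> seg b s e" by (auto simp: seg_def)
    then show False using thin_subset[OF new(2)] seg_subset that by blast
  qed
  have bmono: "b x \<le> b y" if "x \<in> V" "y \<in> V" "x \<le> y" for x y
    using assms(2) that by (auto simp: mono_on_def)
  have m: "m \<in> V" "lab t m \<in> {merged1 t, merged2 t}" "\<And>v. v \<in> V \<Longrightarrow> lab t v = lab t m \<Longrightarrow> m \<le> v"
    using assms(4) unfolding loses_lead_def leads_def by auto
  have M: "M \<in> V" "lab t M \<in> {merged1 t, merged2 t}" "\<And>v. v \<in> V \<Longrightarrow> lab t v = lab t M \<Longrightarrow> v \<le> M"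
    using assms(5) unfolding loses_lead_def leads_def by auto
  obtain x where x: "x \<in> seg b s e" "lab t x = lab t m" using m(2) meets by (metis empty_iff imageE insert_iff)
  then have "b m \<le> e" using bmono[OF m(1), of x] m(3)[of x] by (auto simp: seg_def)
  then have ms: "b m < s" using out[OF nt(1)] by simp
  obtain y where y: "y \<in> seg b s e" "lab t y = lab t M" using M(2) meets by (metis empty_iff imageE insert_iff)
  then have "s \<le> b M" using bmono[OF _ M(1), of y] M(3)[of y] by (auto simp: seg_def)
  then have Me: "e < b M" using out[OF nt(2)] by simp
  \<comment> \<open>\<open>m\<close> and \<open>M\<close> may belong to different merged parts.
    Elements of the same part \<open>merged1 t\<close> further out on both sides are needed to
    enclose the segment.\<close>
  obtain x' where x': "x' \<in> V" "lab t x' = merged1 t" "x' \<le> m"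
    using assms(4) unfolding loses_lead_def by auto
  obtain y' where y': "y' \<in> V" "lab t y' = merged1 t" "M \<le> y'"
    using assms(5) unfolding loses_lead_def by auto
  have "thin t (seg b s e)"
  proof (rule thin_if_between[of t x' y'])
    fix u assume u: "u \<in> seg b s e"
    then have "b x' < b u" "b u < b y'"
      using bmono[OF x'(1) m(1) x'(3)] bmono[OF M(1) y'(1) y'(3)] ms Me by (auto simp: seg_def)
    then show "x' \<le> u \<and> u \<le> y'"
      using bmono[of u x'] bmono[of y' u] x' y' u seg_subset by (metis linorder_not_le nle_le subsetD)
  qed (use assms(1) x' y' seg_subset in auto)
  then show False using new by blast
qed

text \<open>Each such step removes a minimum or a maximum from a block that is thin after the step.
  Each of the \<open>n\<close> blocks pays for at most \<open>Suc D\<close> lost minima and as many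
  lost maxima.\<close>

lemma card_thinning_times_le:
  assumes "mono_on V b" "\<And>v. v \<in> V \<Longrightarrow> b v < n"
  shows "card {t. t < T \<and> (\<exists>s e. newly_thin b t s e)} \<le> 2 * (n * Suc D)"
proof -
  define m where "m t = (SOME v. loses_lead int t v)" for t
  define M where "M t = (SOME v. loses_lead (\<lambda>v. - int v) t v)" for t
  have inj: "inj int" "inj (\<lambda>v. - int v)" by (auto simp: inj_def)
  have m: "loses_lead int t (m t)" if "t < T" for t
    unfolding m_def by (rule someI_ex[OF ex_loses_lead[OF that inj(1)]])
  have M: "loses_lead (\<lambda>v. - int v) t (M t)" if "t < T" for t
    unfolding M_def by (rule someI_ex[OF ex_loses_lead[OF that inj(2)]])
  have inV: "m t \<in> V" "M t \<in> V" if "t < T" for t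
    using m[OF that] M[OF that] by (auto simp: loses_lead_def leads_def)
  define S where "S r l = {t. t < T \<and> b (r t) = l \<and> thin (Suc t) (seg b l l)}" for r :: "nat \<Rightarrow> nat" and l
  have fin: "finite (S r l)" for r l unfolding S_def by simp
  have cm: "card (S m l) \<le> Suc D" for l
    by (rule card_loses_lead_le[OF inj(1), of _ "seg b l l" m])
      (auto simp: S_def m inV seg_def)
  have cM: "card (S M l) \<le> Suc D" for l
    by (rule card_loses_lead_le[OF inj(2), of _ "seg b l l" M])
      (auto simp: S_def M inV seg_def)
  have "{t. t < T \<and> (\<exists>s e. newly_thin b t s e)} \<subseteq> (\<Union>l<n. S m l) \<union> (\<Union>l<n. S M l)"
  proof
    fix t assume "t \<in> {t. t < T \<and> (\<exists>s e. newly_thin b t s e)}"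
    then obtain s e where t: "t < T" "newly_thin b t s e" by blast
    show "t \<in> (\<Union>l<n. S m l) \<union> (\<Union>l<n. S M l)"
      using lost_lead_in_thin_block[OF t(1) assms(1) t(2) m[OF t(1)] M[OF t(1)]]
        assms(2)[OF inV(1)[OF t(1)]] assms(2)[OF inV(2)[OF t(1)]] t(1)
      unfolding S_def by auto
  qed
  then have "card {t. t < T \<and> (\<exists>s e. newly_thin b t s e)} \<le> card ((\<Union>l<n. S m l) \<union> (\<Union>l<n. S M l))"
    using fin by (intro card_mono) auto
  also have "\<dots> \<le> card (\<Union>l<n. S m l) + card (\<Union>l<n. S M l)" by (rule card_Un_le)
  also have "\<dots> \<le> card {..<n} * Suc D + card {..<n} * Suc D"
    by (intro add_mono card_UN_le_mult cm cM) auto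
  finally show ?thesis by simp
qed

text \<open>All segments that become thin meet the merged part, so that the one with the smallest start, the one
  with the largest end and the convex hull of the merged part cover all of them.\<close>

lemma card_labels_newly_thin_le:
  assumes "t < T" "mono_on V b"
  shows "card (lab (Suc t) ` (\<Union>(s, e)\<in>{(s, e). e < n \<and> newly_thin b t s e}. seg b s e)) \<le> 3 * D"
proof (cases "{(s, e). e < n \<and> newly_thin b t s e} = {}")
  case False
  let ?R = "{(s, e). e < n \<and> newly_thin b t s e}"
  have bmono: "b x \<le> b y" if "x \<in> V" "y \<in> V" "x \<le> y" for x y
    using assms(2) that by (auto simp: mono_on_def)
  obtain z where z: "z \<in> V" "lab t z = merged1 t" using merged(1)[OF assms(1)] by auto
  have meets: "\<exists>x\<in>seg b s e. lab (Suc t) x = lab (Suc t) z" if "newly_thin b t s e" for s e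
  proof -
    have "merged1 t \<in> lab t ` seg b s e"
      using that unfolding newly_thin_def
      by (intro newly_thin_meets_merged(1)[OF assms(1) seg_subset]) auto
    then obtain x where x: "x \<in> seg b s e" "lab t x = merged1 t" by auto
    then have "lab (Suc t) x = lab (Suc t) z"
      using merged(4)[OF assms(1), of x z] z by (auto simp: seg_def)
    then show ?thesis using x(1) by blast
  qed
  have thin: "card (lab (Suc t) ` seg b s e) \<le> D" if "newly_thin b t s e" for s e
    using that unfolding newly_thin_def thin_def by simp
  define s1 where "s1 = (LEAST s. \<exists>e. (s, e) \<in> ?R)"
  have "\<exists>e. (s1, e) \<in> ?R" unfolding s1_def by (rule LeastI_ex) (use False in auto)
  then obtain e1 where 1: "newly_thin b t s1 e1" by auto
  have s1: "s1 \<le> s" if "(s, e) \<in> ?R" for s e unfolding s1_def by (rule Least_le) (use that in auto)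
  let ?E = "snd ` ?R"
  have finE: "finite ?E" by (rule finite_subset[of _ "{..<n}"]) auto
  define e2 where "e2 = Max ?E"
  have "e2 \<in> ?E" unfolding e2_def using finE False by (intro Max_in) auto
  then obtain s2 where 2: "newly_thin b t s2 e2" by auto
  have e2: "e \<le> e2" if "(s, e) \<in> ?R" for s e
    unfolding e2_def using finE that by (intro Max_ge) (auto intro: rev_image_eqI)
  obtain x where x: "x \<in> seg b s1 e1" "lab (Suc t) x = lab (Suc t) z" using meets[OF 1] by blast
  obtain y where y: "y \<in> seg b s2 e2" "lab (Suc t) y = lab (Suc t) z" using meets[OF 2] by blast
  let ?N = "{l \<in> lab (Suc t) ` V. near (Suc t) (lab (Suc t) z) l}"
  have "lab (Suc t) ` (\<Union>(s, e)\<in>?R. seg b s e)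
      \<subseteq> lab (Suc t) ` seg b s1 e1 \<union> lab (Suc t) ` seg b s2 e2 \<union> ?N"
  proof
    fix l assume "l \<in> lab (Suc t) ` (\<Union>(s, e)\<in>?R. seg b s e)"
    then obtain s e v where v: "(s, e) \<in> ?R" "v \<in> seg b s e" "l = lab (Suc t) v" by auto
    have inV: "v \<in> V" "x \<in> V" "y \<in> V" using v x y seg_subset by auto
    \<comment> \<open>To the left of \<open>x\<close>, the segment with the smallest start contains
      \<open>v\<close>; to the right of \<open>y\<close>, the one with the largest end does. In
      between, the part of \<open>v\<close> is near the merged part. Each of the three contributes
      \<open>D\<close> labels.\<close>
    consider "v \<le> x" | "y \<le> v" | "x \<le> v" "v \<le> y" by linarith
    then show "l \<in> lab (Suc t) ` seg b s1 e1 \<union> lab (Suc t) ` seg b s2 e2 \<union> ?N"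
    proof cases
      case 1
      then have "v \<in> seg b s1 e1" using v x s1[OF v(1)] bmono[OF inV(1,2) 1] inV by (auto simp: seg_def)
      then show ?thesis using v by auto
    next
      case 2
      then have "v \<in> seg b s2 e2" using v y e2[OF v(1)] bmono[OF inV(3,1) 2] inV by (auto simp: seg_def)
      then show ?thesis using v by auto
    next
      case 3
      then have "near (Suc t) (lab (Suc t) x) (lab (Suc t) v)"
        using near_between[of "Suc t" x v y] inV x y assms(1) by auto
      then show ?thesis using v x inV by auto
    qed
  qed
  then have "card (lab (Suc t) ` (\<Union>(s, e)\<in>?R. seg b s e))
      \<le> card (lab (Suc t) ` seg b s1 e1 \<union> lab (Suc t) ` seg b s2 e2 \<union> ?N)"
    using finite_V finite_sub[OF seg_subset] by (intro card_mono) auto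
  also have "\<dots> \<le> (card (lab (Suc t) ` seg b s1 e1) + card (lab (Suc t) ` seg b s2 e2)) + card ?N"
    by (meson add_le_mono1 card_Un_le le_trans)
  also have "\<dots> \<le> (D + D) + D"
    using thin[OF 1] thin[OF 2] card_near[of "Suc t" z] assms(1) z by (intro add_mono) auto
  finally show ?thesis by simp
next
  case True
  then show ?thesis by (simp only:) simp
qed

end

text \<open>Per block, \<open>2 * D ^ 2 + 2\<close> pairs in which the block becomes thin no later
  than the segment. The rest are \<open>12 * D ^ 2\<close> pairs for each of at most
  \<open>2 * Suc D\<close> thinning steps per block.\<close>

definition rows_const :: "nat \<Rightarrow> nat" where
  "rows_const D = 2 * D ^ 2 + 2 + 24 * D ^ 2 * Suc D"

context contraction_labelling
begin

text \<open>Without near parts the cell is constant on pairs of labels. A thin \<open>U\<close> then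
  shows at most \<open>D\<close> rows, a thin \<open>W\<close> at most \<open>card Q ^ D\<close>,
  and \<open>h\<close> is at least both.\<close>

lemma ex_near_if_many_rows:
  assumes "t \<le> T" "U \<subseteq> V" "W \<subseteq> V" "thin t U \<or> thin t W"
    and Q: "finite Q" "Q \<noteq> {}" "\<And>u w. u \<in> V \<Longrightarrow> w \<in> V \<Longrightarrow> f u w \<in> Q"
    and h: "D \<le> h" "card Q ^ D \<le> h" "h < nrows f U W"
  shows "\<exists>u\<in>U. \<exists>w\<in>W. near t (lab t u) (lab t w)"
proof (rule ccontr)
  assume *: "\<not> ?thesis"
  from assms(4) show False
  proof
    assume "thin t U"
    then show False
      using nrows_le_if_not_near[OF assms(1-3)] * h(1,3) unfolding thin_def by force
  next
    assume "thin t W"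
    then have "nrows f U W \<le> card Q ^ D"
    proof (intro nrows_le_power[where g = "lab t"])
      fix u w w' assume "u \<in> U" "w \<in> W" "w' \<in> W" "lab t w = lab t w'"
      then show "f u w = f u w'"
        using homogeneous[OF assms(1), of u u w w'] * assms(2,3) by blast
    qed (use assms(2,3) Q finite_sub[OF assms(3)] in \<open>auto simp: thin_def\<close>)
    then show False using h by simp
  qed
qed

lemma nrows_le_if_thin_0:
  assumes "W \<subseteq> V" "U \<subseteq> V" "thin 0 W"
    and Q: "finite Q" "Q \<noteq> {}" "\<And>u w. u \<in> V \<Longrightarrow> w \<in> V \<Longrightarrow> f u w \<in> Q"
  shows "nrows f U W \<le> card Q ^ D"
proof (rule nrows_le_power[where g = "lab 0"])
  fix u w w' assume "w \<in> W" "w' \<in> W" "lab 0 w = lab 0 w'"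
  then show "f u w = f u w'" using inj_onD[OF init, of w w'] assms(1) by auto
qed (use assms finite_sub[OF assms(1)] in \<open>auto simp: thin_def\<close>)

text \<open>Double counting of the \<open>p * card X\<close> pairs of a block and one of its
  segments. As soon as one of the two is thin, they have near parts; the few parts near the thin one
  can meet only few of the partners that are not yet thin, since these are ordered and
  disjoint.\<close>

lemma card_blocks_with_many_complex_segments:
  assumes b: "mono_on V b" "\<And>v. v \<in> V \<Longrightarrow> b v < n"
    and Q: "finite Q" "Q \<noteq> {}" "\<And>u w. u \<in> V \<Longrightarrow> w \<in> V \<Longrightarrow> f u w \<in> Q"
    and h: "D \<le> h" "card Q ^ D \<le> h"
    and X: "X \<subseteq> {..<n}"
    and se: "\<And>a i. a \<in> X \<Longrightarrow> i < p \<Longrightarrow> e a i < n"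
      "\<And>a i j. a \<in> X \<Longrightarrow> i < j \<Longrightarrow> j < p \<Longrightarrow> e a i < s a j"
      "\<And>a i. a \<in> X \<Longrightarrow> i < p \<Longrightarrow> h < nrows f (seg b a a) (seg b (s a i) (e a i))"
  shows "p * card X \<le> rows_const D * n"
proof -
  let ?I = "\<lambda>a. seg b a a" and ?g = "\<lambda>a i. seg b (s a i) (e a i)"
  have bmono: "b x \<le> b y" if "x \<in> V" "y \<in> V" "x \<le> y" for x y
    using b(1) that by (auto simp: mono_on_def)
  have seg_less: "x \<le> y" if "x \<in> seg b s1 e1" "y \<in> seg b s2 e2" "e1 < s2" for x y s1 e1 s2 e2
    using bmono[of y x] that by (force simp: seg_def)
  have finX: "finite X" using X finite_subset by blast
  have cX: "card X \<le> n" using card_mono[OF _ X] by simp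
  have near: "lab t ` ?g a i \<inter> nbs t (?I a) \<noteq> {}" "lab t ` ?I a \<inter> nbs t (?g a i) \<noteq> {}"
    if ai: "a \<in> X" "i < p" "t \<le> T" "thin t (?I a) \<or> thin t (?g a i)" for a i t
  proof -
    obtain u w where uw: "u \<in> ?I a" "w \<in> ?g a i" "near t (lab t u) (lab t w)"
      using ex_near_if_many_rows[OF ai(3) seg_subset seg_subset ai(4) Q h se(3)[OF ai(1,2)]] by blast
    show "lab t ` ?g a i \<inter> nbs t (?I a) \<noteq> {}" "lab t ` ?I a \<inter> nbs t (?g a i) \<noteq> {}"
      using uw near_sym[OF uw(3)] seg_subset unfolding nbs_def by blast+
  qed
  \<comment> \<open>A segment that is thin at time 0 has at most \<open>D\<close> elements, too few
    for more than \<open>h\<close> rows. So its thinning happens in an actual merge.\<close>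
  have pos: "0 < first_thin (?g a i)" if "a \<in> X" "i < p" for a i
  proof (rule ccontr)
    assume "\<not> ?thesis"
    then have "thin 0 (?g a i)" using thin_iff_first_thin[OF seg_subset, of 0] by simp
    then have "nrows f (?I a) (?g a i) \<le> card Q ^ D"
      by (intro nrows_le_if_thin_0 seg_subset Q)
    then show False using se(3)[OF that] h by simp
  qed
  \<comment> \<open>All segments that become thin in this step meet \<open>merged1 t\<close> while
    not yet thin; of three of them, the middle one would have been thin already.\<close>
  have at_step: "card A \<le> 2"
    if "a \<in> X" "t < T" "\<And>i. i \<in> A \<Longrightarrow> i < p \<and> first_thin (?g a i) = Suc t" for a t A
  proof (rule card_nonthin_meeting_label[of t A "?g a" "merged1 t"])
    show "finite A" using that(3) by (meson finite_nat_set_iff_bounded)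
    fix i assume i: "i \<in> A"
    show nt: "\<not> thin t (?g a i)"
      using thin_iff_first_thin[OF seg_subset, of t] that(2) that(3)[OF i] by simp
    have "thin (Suc t) (?g a i)"
      using thin_iff_first_thin[OF seg_subset, of "Suc t"] that(2) that(3)[OF i] by simp
    then show "merged1 t \<in> lab t ` ?g a i"
      by (rule newly_thin_meets_merged(1)[OF that(2) seg_subset nt])
  next
    fix i j x y assume "i \<in> A" "j \<in> A" "i < j" "x \<in> ?g a i" "y \<in> ?g a j"
    then show "x \<le> y" using seg_less[of x _ _ y] se(2)[of a i j] that by blast
  qed (use that seg_subset in auto)

  \<comment> \<open>\<open>P1\<close>: the block becomes thin first, so its few neighbouring parts meet few of the segments that
    are not yet thin. \<open>P2\<close>: the segment becomes thin first, in one of the few steps in which this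
    happens to some segment.\<close>
  define P1 where "P1 = (SIGMA a:X. {i. i < p \<and> first_thin (?I a) \<le> first_thin (?g a i)})"
  define P2 where "P2 = (SIGMA a:X. {i. i < p \<and> first_thin (?g a i) < first_thin (?I a)})"
  have "X \<times> {..<p} = P1 \<union> P2" unfolding P1_def P2_def by auto
  then have "p * card X \<le> card P1 + card P2"
    using card_Un_le[of P1 P2] by (metis card_cartesian_product card_lessThan mult.commute)
  moreover have "card P1 \<le> card X * (2 * D ^ 2 + 2)"
    unfolding P1_def
  proof (rule card_Sigma_le[OF finX])
    fix a assume a: "a \<in> X"
    let ?t = "first_thin (?I a)"
    have tT: "?t \<le> T" by (rule first_thin_le[OF seg_subset])
    \<comment> \<open>Segments thinning strictly after the block are still not thin at
      \<open>?t\<close>, so the \<open>D * D\<close> labels near the block control them. Those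
      thinning in the same step are left to \<open>at_step\<close>.\<close>
    let ?A1 = "{i. i < p \<and> ?t < first_thin (?g a i)}" and ?A2 = "{i. i < p \<and> first_thin (?g a i) = ?t}"
    have thinI: "thin ?t (?I a)" using thin_iff_first_thin[OF seg_subset tT] by simp
    have "card ?A1 \<le> card (nbs ?t (?I a)) * 2"
    proof (rule card_nonthin_meeting_labels[OF tT, of ?A1 "?g a"])
      fix i assume "i \<in> ?A1"
      then show "\<not> thin ?t (?g a i)" "lab ?t ` ?g a i \<inter> nbs ?t (?I a) \<noteq> {}"
        using thin_iff_first_thin[OF seg_subset tT] near(1)[OF a _ tT] thinI by auto
    next
      fix i j x y assume "i \<in> ?A1" "j \<in> ?A1" "i < j" "x \<in> ?g a i" "y \<in> ?g a j"
      then show "x \<le> y" using seg_less[of x _ _ y] se(2)[of a i j] a by blast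
    qed (use seg_subset finite_nbs in auto)
    also have "card (nbs ?t (?I a)) \<le> D * D"
      using card_nbs_le[OF tT seg_subset, of b a a] thinI unfolding thin_def
      by (meson le_trans mult_le_mono1)
    finally have "card ?A1 \<le> 2 * D ^ 2" by (simp add: power2_eq_square)
    moreover have "card ?A2 \<le> 2"
    proof (cases "?A2 = {}")
      case False
      then have "0 < ?t" using pos a by fastforce
      then obtain t where "?t = Suc t" using gr0_implies_Suc by blast
      then show ?thesis using tT at_step[OF a, of t ?A2] by simp
    next
      case True
      then show ?thesis by (simp only:) simp
    qed
    moreover have "{i. i < p \<and> ?t \<le> first_thin (?g a i)} = ?A1 \<union> ?A2" by auto
    ultimately show "card {i. i < p \<and> ?t \<le> first_thin (?g a i)} \<le> 2 * D ^ 2 + 2"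
      using card_Un_le[of ?A1 ?A2] by simp
  qed simp
  moreover have "card P2 \<le> 2 * (n * Suc D) * (12 * D ^ 2)"
  proof -
    let ?R = "{t. t < T \<and> (\<exists>s e. newly_thin b t s e)}"
    define A where "A t = {a \<in> X. Suc t < first_thin (?I a) \<and>
      (\<exists>i<p. first_thin (?g a i) = Suc t)}" for t
    define S where "S t = (SIGMA a:A t. {i. i < p \<and> first_thin (?g a i) = Suc t})" for t
    have new: "newly_thin b t (s a i) (e a i)" if "first_thin (?g a i) = Suc t" "t < T" for a i t
      using that thin_iff_first_thin[OF seg_subset] unfolding newly_thin_def by auto
    have le_T: "first_thin (seg b x y) \<le> T" for x y by (rule first_thin_le[OF seg_subset])
    have "P2 \<subseteq> (\<Union>t\<in>?R. S t)"
    proof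
      fix z assume "z \<in> P2"
      then obtain a i where z: "z = (a, i)" "a \<in> X" "i < p" "first_thin (?g a i) < first_thin (?I a)"
        unfolding P2_def by auto
      obtain t where t: "first_thin (?g a i) = Suc t" using pos[OF z(2,3)] gr0_implies_Suc by blast
      have "t < T" using t le_T[of "s a i" "e a i"] by simp
      then show "z \<in> (\<Union>t\<in>?R. S t)" using z t new[OF t] unfolding S_def A_def by auto
    qed
    moreover have fin: "finite (S t)" for t
      unfolding S_def A_def using finX by (intro finite_SigmaI) auto
    ultimately have "card P2 \<le> card (\<Union>t\<in>?R. S t)" by (intro card_mono) auto
    also have "\<dots> \<le> card ?R * (12 * D ^ 2)"
    proof (rule card_UN_le_mult)
      fix t assume "t \<in> ?R"
      then have t: "t < T" "Suc t \<le> T" by auto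
      let ?U = "\<Union>(s, e)\<in>{(s, e). e < n \<and> newly_thin b t s e}. seg b s e"
      have US: "?U \<subseteq> V" using seg_subset by auto
      \<comment> \<open>The newly thin segments together have at most \<open>3 * D\<close> labels,
        hence \<open>3 * D * D\<close> near parts, and each of these meets at most two blocks that
        are not thin.\<close>
      have "card (A t) \<le> card (nbs (Suc t) ?U) * 2"
      proof (rule card_nonthin_meeting_labels[OF t(2), of "A t" ?I])
        fix a assume a: "a \<in> A t"
        then obtain i where i: "a \<in> X" "i < p" "first_thin (?g a i) = Suc t" "Suc t < first_thin (?I a)"
          unfolding A_def by auto
        show "\<not> thin (Suc t) (?I a)" using thin_iff_first_thin[OF seg_subset t(2)] i by simp
        have "thin (Suc t) (?g a i)" using thin_iff_first_thin[OF seg_subset t(2)] i by simp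
        then have "lab (Suc t) ` ?I a \<inter> nbs (Suc t) (?g a i) \<noteq> {}" using near(2)[OF i(1,2) t(2)] by blast
        moreover have "nbs (Suc t) (?g a i) \<subseteq> nbs (Suc t) ?U"
          using new[OF i(3) t(1)] se(1)[OF i(1,2)] unfolding nbs_def by blast
        ultimately show "lab (Suc t) ` ?I a \<inter> nbs (Suc t) ?U \<noteq> {}" by blast
      next
        fix i j x y assume "i < j" "x \<in> ?I i" "y \<in> ?I j"
        then show "x \<le> y" using seg_less[of x i i y j j] by blast
      qed (use finX seg_subset finite_nbs in \<open>auto simp: A_def\<close>)
      also have "card (nbs (Suc t) ?U) \<le> 3 * D * D"
        using card_nbs_le[OF t(2) US] card_labels_newly_thin_le[OF t(1) b(1), of n]
        by (meson le_trans mult_le_mono1)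
      finally have cA: "card (A t) \<le> 6 * D ^ 2" by (simp add: power2_eq_square)
      have "card (S t) \<le> card (A t) * 2"
        unfolding S_def
      proof (rule card_Sigma_le)
        fix a assume "a \<in> A t"
        then show "card {i. i < p \<and> first_thin (?g a i) = Suc t} \<le> 2"
          by (intro at_step[of a t]) (use t in \<open>auto simp: A_def\<close>)
      qed (use finX in \<open>auto simp: A_def\<close>)
      then show "card (S t) \<le> 12 * D ^ 2" using cA by simp
    qed simp
    also have "\<dots> \<le> 2 * (n * Suc D) * (12 * D ^ 2)"
      by (rule mult_le_mono1[OF card_thinning_times_le[OF b]])
    finally show ?thesis .
  qed
  ultimately have "p * card X \<le> n * (2 * D ^ 2 + 2) + 2 * (n * Suc D) * (12 * D ^ 2)"
    using mult_le_mono1[OF cX, of "2 * D ^ 2 + 2"] by linarith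
  then show ?thesis unfolding rows_const_def by (simp add: algebra_simps)
qed

end

subsection \<open>Contraction sequences through given partitions\<close>

lemma partition_on_merge:
  assumes "partition_on V P" "X \<in> P" "Y \<in> P" "X \<noteq> Y"
  shows "partition_on V (insert (X \<union> Y) (P - {X, Y}))"
proof (rule partition_onI)
  show "\<Union>(insert (X \<union> Y) (P - {X, Y})) = V"
    using assms partition_onD1[OF assms(1)] by auto
  fix p q assume *: "p \<in> insert (X \<union> Y) (P - {X, Y})" "q \<in> insert (X \<union> Y) (P - {X, Y})" "p \<noteq> q"
  have disj: "disjnt p q" if "p \<in> P" "q \<in> P" "p \<noteq> q" for p q
    using partition_onD2[OF assms(1)] that by (auto simp: disjoint_def disjnt_def)
  have XY: "disjnt (X \<union> Y) q" if "q \<in> P - {X, Y}" for q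
    using disj[of X q] disj[of Y q] assms(2,3) that by (auto simp: disjnt_Un1)
  consider "p \<in> P" "q \<in> P" | "p = X \<union> Y" "q \<in> P - {X, Y}" | "q = X \<union> Y" "p \<in> P - {X, Y}"
    using * by blast
  then show "disjnt p q"
    by cases (use disj *(3) XY in \<open>auto intro: disjnt_sym\<close>)
next
  show "{} \<notin> insert (X \<union> Y) (P - {X, Y})"
    using partition_onD3[OF assms(1)] assms(2) by auto
qed

lemma ex_parts_within_if_refines:
  assumes "refines V Q Q'" "Q \<noteq> Q'"
  obtains X Y Z where "X \<in> Q" "Y \<in> Q" "X \<noteq> Y" "Z \<in> Q'" "X \<subseteq> Z" "Y \<subseteq> Z"
proof -
  have r: "partition_on V Q" "partition_on V Q'" "\<And>X. X \<in> Q \<Longrightarrow> \<exists>Z\<in>Q'. X \<subseteq> Z"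
    using assms(1) unfolding refines_def by auto
  have disj: "X = Y" if "X \<in> P" "Y \<in> P" "x \<in> X" "x \<in> Y" "partition_on V P" for X Y P x
    using that partition_onD2[of V P] by (auto simp: disjoint_def)
  have "\<exists>X\<in>Q. X \<notin> Q'"
  proof (rule ccontr)
    assume "\<not> ?thesis"
    then have sub: "Q \<subseteq> Q'" by auto
    have "Q' \<subseteq> Q"
    proof
      fix Z assume Z: "Z \<in> Q'"
      then obtain x where x: "x \<in> Z" "x \<in> V" using partition_onD1[OF r(2)] partition_onD3[OF r(2)] by (metis Union_iff all_not_in_conv)
      then obtain X where "X \<in> Q" "x \<in> X" using partition_onD1[OF r(1)] by auto
      then show "Z \<in> Q" using disj[of X Q' Z x] sub Z x r(2) by auto
    qed
    then show False using sub assms(2) by simp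
  qed
  then obtain X Z where X: "X \<in> Q" "X \<notin> Q'" "Z \<in> Q'" "X \<subseteq> Z" using r(3) by blast
  then have "\<not> Z \<subseteq> X" by auto
  then obtain y where y: "y \<in> Z" "y \<notin> X" by auto
  then have "y \<in> V" using X(3) partition_onD1[OF r(2)] by auto
  then obtain Y where Y: "Y \<in> Q" "y \<in> Y" using partition_onD1[OF r(1)] by auto
  then obtain Z' where "Z' \<in> Q'" "Y \<subseteq> Z'" using r(3) by blast
  then have "Y \<subseteq> Z" using disj[of Z' Q' Z y] X(3) y Y r(2) by auto
  then show ?thesis using that[of X Y Z] X Y y by blast
qed

text \<open>Merging two parts inside a common part of \<open>Q'\<close> keeps the refinement of
  \<open>Q'\<close> and lowers the number of parts.\<close>

lemma ex_merge_sequence: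
  assumes "finite Q" "refines V Q Q'"
  shows "\<exists>Ps. Ps \<noteq> [] \<and> hd Ps = Q \<and> last Ps = Q' \<and> successively merges Ps \<and>
    (\<forall>P\<in>set Ps. refines V Q P \<and> refines V P Q')"
  using assms
proof (induction "card Q" arbitrary: Q rule: less_induct)
  case less
  show ?case
  proof (cases "Q = Q'")
    case True
    then show ?thesis using less.prems by (intro exI[of _ "[Q]"]) (auto simp: refines_def)
  next
    case False
    then obtain X Y Z where XYZ: "X \<in> Q" "Y \<in> Q" "X \<noteq> Y" "Z \<in> Q'" "X \<subseteq> Z" "Y \<subseteq> Z"
      using ex_parts_within_if_refines[OF less.prems(2)] by metis
    define Q1 where "Q1 = insert (X \<union> Y) (Q - {X, Y})"
    have part: "partition_on V Q1"
      unfolding Q1_def using less.prems XYZ by (intro partition_on_merge) (auto simp: refines_def)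
    have r1: "refines V Q Q1"
      unfolding refines_def
    proof (intro conjI ballI part)
      show "partition_on V Q" using less.prems(2) by (simp add: refines_def)
      fix A assume "A \<in> Q"
      then show "\<exists>B\<in>Q1. A \<subseteq> B" unfolding Q1_def by (cases "A \<in> {X, Y}") auto
    qed
    have r2: "refines V Q1 Q'"
      unfolding refines_def
    proof (intro conjI ballI part)
      show "partition_on V Q'" using less.prems(2) by (simp add: refines_def)
      fix A assume "A \<in> Q1"
      then consider "A = X \<union> Y" | "A \<in> Q" unfolding Q1_def by auto
      then show "\<exists>B\<in>Q'. A \<subseteq> B"
        by cases (use XYZ less.prems(2) in \<open>auto simp: refines_def\<close>)
    qed
    have "card Q1 \<le> Suc (card (Q - {X, Y}))"
      unfolding Q1_def by (rule card_insert_le_m1[of "Suc _", simplified]) simp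
    also have "\<dots> < card Q"
      using XYZ card_mono[OF less.prems(1), of "{X, Y}"] by (simp add: card_Diff_subset)
    finally have "card Q1 < card Q" .
    then obtain Ps where Ps: "Ps \<noteq> []" "hd Ps = Q1" "last Ps = Q'" "successively merges Ps"
      "\<forall>P\<in>set Ps. refines V Q1 P \<and> refines V P Q'"
      using less.hyps[of Q1] less.prems(1) r2 unfolding Q1_def by auto
    have "merges Q Q1" unfolding merges_def Q1_def using XYZ by blast
    then have "successively merges (Q # Ps)" using Ps by (simp add: successively_Cons)
    moreover have "refines V Q P" if "P \<in> set Ps" for P
      using Ps(5) that r1 refines_trans by blast
    moreover have "refines V Q Q"
      using less.prems(2) by (intro refines_refl) (simp add: refines_def)
    ultimately show ?thesis
      using Ps(1,3,5) less.prems(2) by (intro exI[of _ "Q # Ps"]) simp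
  qed
qed

section \<open>Red degrees of partitions between two given ones\<close>

lemma red_adjacent_mono:
  assumes "red_adjacent S X Y" "X \<subseteq> X'" "Y \<subseteq> Y'" "X' \<noteq> Y'"
  shows "red_adjacent S X' Y'"
  using assms unfolding red_adjacent_def by blast

lemma red_adjacent_sym: "red_adjacent S X Y \<Longrightarrow> red_adjacent S Y X"
  unfolding red_adjacent_def atomic_type_def prod.inject by metis

lemma card_parts_within_le:
  assumes "refines V Q P" "finite Q"
  shows "card {Y \<in> P. Y \<subseteq> Z} \<le> card {X \<in> Q. X \<subseteq> Z}"
proof -
  define c where "c Y = (SOME X. X \<in> Q \<and> X \<subseteq> Y)" for Y
  have P: "partition_on V P" and Q: "partition_on V Q" using assms(1) by (auto simp: refines_def)
  have c: "c Y \<in> Q \<and> c Y \<subseteq> Y" if "Y \<in> P" for Y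
  proof -
    have "Y = \<Union>{X \<in> Q. X \<subseteq> Y}" using refines_obtains_subset[OF assms(1) that] partition_onD1 by metis
    moreover have "Y \<noteq> {}" using partition_onD3[OF P] that by auto
    ultimately have "\<exists>X. X \<in> Q \<and> X \<subseteq> Y" by auto
    then show ?thesis unfolding c_def by (rule someI_ex)
  qed
  have "inj_on c {Y \<in> P. Y \<subseteq> Z}"
  proof (rule inj_onI)
    fix Y Y' assume *: "Y \<in> {Y \<in> P. Y \<subseteq> Z}" "Y' \<in> {Y \<in> P. Y \<subseteq> Z}" "c Y = c Y'"
    then have "c Y \<in> Q" "c Y \<subseteq> Y \<inter> Y'" using c[of Y] c[of Y'] by auto
    moreover from this have "c Y \<noteq> {}" using partition_onD3[OF Q] by auto
    ultimately have "Y \<inter> Y' \<noteq> {}" by auto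
    then show "Y = Y'" using * partition_onD2[OF P] by (auto simp: disjoint_def)
  qed
  then show ?thesis
    by (rule card_inj_on_le) (use assms(2) c in auto)
qed

text \<open>Red adjacency passes to the enclosing parts of \<open>Q'\<close> unless these coincide,
  so the red neighbours of \<open>X\<close> lie in \<open>Z\<close> or in one of its
  \<open>d\<close> red neighbours. Each of these contains at most \<open>m\<close> parts of
  \<open>Q\<close>, hence of \<open>P\<close>.\<close>

lemma card_red_between_le:
  assumes "finite V" "refines V Q P" "refines V P Q'" "X \<in> P"
    "\<And>Z. Z \<in> Q' \<Longrightarrow> card {X \<in> Q. X \<subseteq> Z} \<le> m"
    "\<And>Z. Z \<in> Q' \<Longrightarrow> card {Z' \<in> Q'. red_adjacent S Z Z'} \<le> d"
  shows "card {Y \<in> P. red_adjacent S X Y} \<le> Suc d * m"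
proof -
  have parts: "partition_on V Q" "partition_on V P" "partition_on V Q'"
    using assms by (auto simp: refines_def)
  have fin: "finite Q" "finite P" "finite Q'" using parts assms(1) finite_elements by blast+
  obtain Z where Z: "Z \<in> Q'" "X \<subseteq> Z" using assms(3,4) by (auto simp: refines_def)
  let ?N = "insert Z {Z' \<in> Q'. red_adjacent S Z Z'}"
  have "{Y \<in> P. red_adjacent S X Y} \<subseteq> (\<Union>Z'\<in>?N. {Y \<in> P. Y \<subseteq> Z'})"
  proof
    fix Y assume Y: "Y \<in> {Y \<in> P. red_adjacent S X Y}"
    then obtain Z' where Z': "Z' \<in> Q'" "Y \<subseteq> Z'" using assms(3) by (auto simp: refines_def)
    then have "Z' \<in> ?N" using red_adjacent_mono[of S X Y Z Z'] Y Z by auto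
    then show "Y \<in> (\<Union>Z'\<in>?N. {Y \<in> P. Y \<subseteq> Z'})" using Y Z' by blast
  qed
  then have "card {Y \<in> P. red_adjacent S X Y} \<le> card (\<Union>Z'\<in>?N. {Y \<in> P. Y \<subseteq> Z'})"
    using fin by (intro card_mono) auto
  also have "\<dots> \<le> card ?N * m"
  proof (rule card_UN_le_mult)
    fix Z' assume "Z' \<in> ?N"
    then have "Z' \<in> Q'" using Z by auto
    then show "card {Y \<in> P. Y \<subseteq> Z'} \<le> m"
      using card_parts_within_le[OF assms(2) fin(1), of Z'] assms(5)[of Z'] by simp
  qed (use fin in simp)
  also have "\<dots> \<le> Suc d * m"
    using assms(6)[OF Z(1)] fin(3) by (intro mult_le_mono1) (simp add: card_insert_if)
  finally show ?thesis .
qed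

text \<open>A contraction sequence of red degree at most \<open>d\<close>, cut off at
  \<open>Q\<close>. This form can be prolonged stage by stage, with bounds needed only for the
  stages and not for the partitions in between.\<close>

definition reachable :: "('v, 'p, 'r) binary_structure \<Rightarrow> nat \<Rightarrow> 'v set set \<Rightarrow> bool" where
  "reachable S d Q \<longleftrightarrow> (\<exists>Ps. Ps \<noteq> [] \<and> hd Ps = (\<lambda>v. {v}) ` universe S \<and> last Ps = Q \<and>
    successively merges Ps \<and> (\<forall>P\<in>set Ps. \<forall>X\<in>P. card {Y \<in> P. red_adjacent S X Y} \<le> d))"

lemma reachable_singletons: "reachable S d ((\<lambda>v. {v}) ` universe S)"
proof -
  have "\<not> red_adjacent S {u} {v}" for u v by (auto simp: red_adjacent_def)
  then have "{Y \<in> (\<lambda>v. {v}) ` universe S. red_adjacent S {x} Y} = {}" for x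
    by auto
  then have "card {Y \<in> (\<lambda>v. {v}) ` universe S. red_adjacent S {x} Y} \<le> d" for x
    by (metis card.empty le0)
  then show ?thesis
    unfolding reachable_def by (intro exI[of _ "[(\<lambda>v. {v}) ` universe S]"]) simp
qed

lemma reachable_coarsen:
  assumes "reachable S d Q" "finite (universe S)" "refines (universe S) Q Q'"
    "\<And>Z. Z \<in> Q' \<Longrightarrow> card {X \<in> Q. X \<subseteq> Z} \<le> m"
    "\<And>Z. Z \<in> Q' \<Longrightarrow> card {Z' \<in> Q'. red_adjacent S Z Z'} \<le> d'" "Suc d' * m \<le> d"
  shows "reachable S d Q'"
proof -
  obtain Ps where Ps: "Ps \<noteq> []" "hd Ps = (\<lambda>v. {v}) ` universe S" "last Ps = Q"
    "successively merges Ps" "\<forall>P\<in>set Ps. \<forall>X\<in>P. card {Y \<in> P. red_adjacent S X Y} \<le> d"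
    using assms(1) unfolding reachable_def by auto
  have finQ: "finite Q" using assms(2,3) finite_elements unfolding refines_def by blast
  obtain Rs where Rs: "Rs \<noteq> []" "hd Rs = Q" "last Rs = Q'" "successively merges Rs"
    "\<forall>P\<in>set Rs. refines (universe S) Q P \<and> refines (universe S) P Q'"
    using ex_merge_sequence[OF finQ assms(3)] by auto
  have bound: "card {Y \<in> P. red_adjacent S X Y} \<le> d" if "P \<in> set Rs" "X \<in> P" for P X
    using card_red_between_le[OF assms(2), of Q P Q' X m S d'] Rs(5) that assms(4-6) by fastforce
  obtain R Rs' where R: "Rs = Q # Rs'" using Rs(1,2) by (cases Rs) auto
  have "successively merges (Ps @ Rs')"
    using Ps Rs(4) R by (cases Rs') (auto simp: successively_append_iff)
  moreover have "last (Ps @ Rs') = Q'" using Ps(1,3) Rs(3) R by (cases "Rs' = []") simp_all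
  ultimately show ?thesis
    unfolding reachable_def using Ps bound R
    by (intro exI[of _ "Ps @ Rs'"]) auto
qed

lemma partition_on_singletons: "partition_on V ((\<lambda>v. {v}) ` V)"
  by (auto simp: partition_on_def disjoint_def)

lemma contraction_sequence_if_reachable:
  assumes "reachable S d Q" "finite (universe S)" "partition_on (universe S) Q" "card Q \<le> d"
  shows "\<exists>Ps. contraction_sequence (universe S) Ps \<and>
    (\<forall>P\<in>set Ps. \<forall>X\<in>P. card {Y \<in> P. red_adjacent S X Y} \<le> d)"
proof -
  \<comment> \<open>On the empty universe this is the empty partition, which
    \<open>contraction_sequence\<close> admits as the last one.\<close>
  define Q' where "Q' = {universe S} - {{}}"
  have part: "partition_on (universe S) Q'"
    unfolding Q'_def by (auto simp: partition_on_def disjoint_def)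
  have r: "refines (universe S) Q Q'"
    unfolding refines_def
  proof (intro conjI ballI assms(3) part)
    fix X assume X: "X \<in> Q"
    then have "X \<subseteq> universe S" "X \<noteq> {}"
      using partition_onD1[OF assms(3)] partition_onD3[OF assms(3)] by auto
    then show "\<exists>Z\<in>Q'. X \<subseteq> Z" unfolding Q'_def by auto
  qed
  have fin: "finite Q" using assms(2,3) finite_elements by blast
  have "reachable S d Q'"
  proof (rule reachable_coarsen[OF assms(1,2) r])
    fix Z
    show "card {X \<in> Q. X \<subseteq> Z} \<le> d" using card_mono[OF fin, of "{X \<in> Q. X \<subseteq> Z}"] assms(4) by auto
    assume "Z \<in> Q'"
    then have "{Z' \<in> Q'. red_adjacent S Z Z'} = {}" by (auto simp: Q'_def red_adjacent_def)
    then show "card {Z' \<in> Q'. red_adjacent S Z Z'} \<le> 0" by (simp only: card.empty)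
  qed simp
  then obtain Ps where Ps: "Ps \<noteq> []" "hd Ps = (\<lambda>v. {v}) ` universe S" "last Ps = Q'"
    "successively merges Ps" "\<forall>P\<in>set Ps. \<forall>X\<in>P. card {Y \<in> P. red_adjacent S X Y} \<le> d"
    unfolding reachable_def by auto
  show ?thesis
    unfolding contraction_sequence_def using Ps by (intro exI[of _ Ps]) (auto simp: Q'_def)
qed

lemma twin_width_le_if_reachable:
  assumes "reachable S d Q" "finite (universe S)" "partition_on (universe S) Q" "card Q \<le> d"
  shows "twin_width S \<le> d"
  unfolding twin_width_def by (rule Least_le) (rule contraction_sequence_if_reachable[OF assms])

text \<open>The \<open>LEAST\<close> is attained because merging the singletons in any order has red
  degree at most their number.\<close>

lemma obtain_optimal_contraction_sequence:
  assumes "finite (universe S)"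
  obtains Ps where "contraction_sequence (universe S) Ps"
    "\<forall>P\<in>set Ps. \<forall>X\<in>P. card {Y \<in> P. red_adjacent S X Y} \<le> twin_width S"
proof -
  have "\<exists>d Ps. contraction_sequence (universe S) Ps \<and>
    (\<forall>P\<in>set Ps. \<forall>X\<in>P. card {Y \<in> P. red_adjacent S X Y} \<le> d)"
    using contraction_sequence_if_reachable[OF reachable_singletons assms partition_on_singletons order_refl]
    by (rule exI)
  then have "\<exists>Ps. contraction_sequence (universe S) Ps \<and>
    (\<forall>P\<in>set Ps. \<forall>X\<in>P. card {Y \<in> P. red_adjacent S X Y} \<le> twin_width S)"
    unfolding twin_width_def by (rule LeastI_ex)
  then show ?thesis using that by (elim exE conjE)
qed

subsection \<open>Divisions with few rows outside few blocks\<close>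

text \<open>The invariant kept while merging. \<open>Y\<close> contains numbers of blocks, so
  renumbering acts on it by an image; one bound serves both counts.\<close>

definition few_rows_outside ::
  "nat set \<Rightarrow> (nat \<Rightarrow> nat \<Rightarrow> 'c) \<Rightarrow> (nat \<Rightarrow> nat) \<Rightarrow> nat \<Rightarrow> nat \<Rightarrow> bool" where
  "few_rows_outside V f b k a \<longleftrightarrow>
    (\<exists>Y. finite Y \<and> card Y \<le> k \<and> nrows f {v \<in> V. b v = a} {w \<in> V. b w \<notin> Y} \<le> k)"

lemma nrows_Un_le:
  assumes "finite U"
  shows "nrows f U (W \<union> W') \<le> nrows f U W * nrows f U W'"
proof -
  let ?r = "\<lambda>W u. restrict (f u) W"
  have "nrows f U (W \<union> W') \<le> card ((\<lambda>u. (?r W u, ?r W' u)) ` U)"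
  proof (rule nrows_le_if_determined)
    fix u v w assume w: "w \<in> W \<union> W'" and "(?r W u, ?r W' u) = (?r W v, ?r W' v)"
    then have "?r W u w = ?r W v w" "?r W' u w = ?r W' v w" by simp_all
    then show "f u w = f v w" using w by (auto simp del: restrict_apply simp: restrict_apply')
  qed (use assms in simp)
  also have "\<dots> \<le> card (?r W ` U \<times> ?r W' ` U)"
    using assms by (intro card_mono) auto
  also have "\<dots> = nrows f U W * nrows f U W'" by (simp add: nrows_def card_cartesian_product)
  finally show ?thesis .
qed

lemma nrows_empty_le: "finite U \<Longrightarrow> nrows f U {} \<le> 1"
  using card_mono[of "{\<lambda>x. undefined}" "(\<lambda>u. restrict (f u) {}) ` U"]
  unfolding nrows_def by (auto simp: restrict_def)

text \<open>Cutting greedily, as soon as the current segment shows more than \<open>h\<close> rows: either there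
  are \<open>p\<close> cuts, or the cut blocks can serve as the exceptional ones.\<close>

lemma ex_segments_or_few_rows:
  assumes "finite U" "finite V" "\<forall>v\<in>V. b v < n" "1 \<le> h"
  shows "(\<exists>s e. (\<forall>i<p. x \<le> s i \<and> e i < n \<and> h < nrows f U {v \<in> V. s i \<le> b v \<and> b v \<le> e i}) \<and>
      (\<forall>i j. i < j \<longrightarrow> j < p \<longrightarrow> (e i :: nat) < s j)) \<or>
    (\<exists>Y. finite Y \<and> card Y \<le> p \<and> nrows f U {v \<in> V. x \<le> b v \<and> b v \<notin> Y} \<le> h ^ Suc p)"
    (is "?S p x \<or> ?Y p x")
proof (induction p arbitrary: x)
  case 0
  show ?case by simp
next
  case (Suc p)
  let ?seg = "\<lambda>s e. {v \<in> V. s \<le> b v \<and> b v \<le> e}"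
  show ?case
  proof (cases "\<exists>e<n. h < nrows f U (?seg x e)")
    case False
    have "nrows f U {v \<in> V. x \<le> b v \<and> b v \<notin> {}} \<le> h"
    proof (cases n)
      case 0
      then have "V = {}" using assms(3) by auto
      then show ?thesis using nrows_empty_le[OF assms(1), of f] assms(4) by simp
    next
      case (Suc m)
      then have "{v \<in> V. x \<le> b v \<and> b v \<notin> {}} = ?seg x m" using assms(3) by (auto simp: less_Suc_eq_le)
      then show ?thesis using False Suc by auto
    qed
    also have "h \<le> h ^ Suc (Suc p)" using assms(4) by (intro self_le_power) auto
    finally show ?thesis by (intro disjI2 exI[of _ "{}"]) simp
  next
    case True
    \<comment> \<open>End of the shortest segment from \<open>x\<close> with more than
      \<open>h\<close> rows. Strictly before \<open>y\<close> there are at most \<open>h\<close>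
      rows, and block \<open>y\<close> itself, over which there is no control, becomes exceptional.
      Each of the at most \<open>p + 1\<close> gaps thus contributes a factor
      \<open>h\<close>.\<close>
    define y where "y = (LEAST e. e < n \<and> h < nrows f U (?seg x e))"
    have y: "y < n" "h < nrows f U (?seg x y)"
      using LeastI_ex[OF True] unfolding y_def by auto
    have before: "nrows f U {v \<in> V. x \<le> b v \<and> b v < y} \<le> h"
    proof (cases y)
      case 0
      then show ?thesis using nrows_empty_le[OF assms(1), of f] assms(4) by simp
    next
      case (Suc m)
      then have "\<not> (m < n \<and> h < nrows f U (?seg x m))"
        using not_less_Least[of m "\<lambda>e. e < n \<and> h < nrows f U (?seg x e)"] unfolding y_def by simp
      moreover have "{v \<in> V. x \<le> b v \<and> b v < y} = ?seg x m" using Suc by auto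
      ultimately show ?thesis using Suc y(1) by simp
    qed
    from Suc.IH[of "Suc y"] show ?thesis
    proof
      assume "?S p (Suc y)"
      then obtain s e where se: "\<And>i. i < p \<Longrightarrow> Suc y \<le> s i \<and> e i < n \<and> h < nrows f U (?seg (s i) (e i))"
        "\<And>i j. i < j \<Longrightarrow> j < p \<Longrightarrow> e i < s j" by blast
      define s' where "s' i = (case i of 0 \<Rightarrow> x | Suc j \<Rightarrow> s j)" for i
      define e' where "e' i = (case i of 0 \<Rightarrow> y | Suc j \<Rightarrow> e j)" for i
      \<comment> \<open>An empty segment may still show one row, which does not exceed
        \<open>h\<close>.\<close>
      have xy: "x \<le> y"
      proof (rule ccontr)
        assume "\<not> x \<le> y"
        then have empty: "?seg x y = {}" by auto
        show False using y(2) nrows_empty_le[OF assms(1), of f] assms(4) unfolding empty by simp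
      qed
      have "x \<le> s' i \<and> e' i < n \<and> h < nrows f U (?seg (s' i) (e' i))" if "i < Suc p" for i
      proof (cases i)
        case 0 then show ?thesis using y by (simp add: s'_def e'_def)
      next
        case (Suc j)
        then have "j < p" using that by simp
        then show ?thesis using se(1)[of j] xy Suc by (simp add: s'_def e'_def)
      qed
      moreover have "e' i < s' j" if "i < j" "j < Suc p" for i j
      proof -
        obtain j' where j: "j = Suc j'" "j' < p" using \<open>i < j\<close> \<open>j < Suc p\<close> by (cases j) auto
        show ?thesis
          using se(1)[OF j(2)] se(2)[of "i - 1" j'] j that by (cases i) (auto simp: s'_def e'_def)
      qed
      ultimately show ?thesis by blast
    next
      assume "?Y p (Suc y)"
      then obtain Y where Y: "finite Y" "card Y \<le> p"
        "nrows f U {v \<in> V. Suc y \<le> b v \<and> b v \<notin> Y} \<le> h ^ Suc p" by blast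
      let ?A = "{v \<in> V. x \<le> b v \<and> b v < y}" and ?B = "{v \<in> V. Suc y \<le> b v \<and> b v \<notin> Y}"
      have "nrows f U {v \<in> V. x \<le> b v \<and> b v \<notin> insert y Y} \<le> nrows f U (?A \<union> ?B)"
        by (rule nrows_mono[OF assms(1)]) auto
      also have "\<dots> \<le> nrows f U ?A * nrows f U ?B" by (rule nrows_Un_le[OF assms(1)])
      also have "\<dots> \<le> h * h ^ Suc p" by (rule mult_le_mono[OF before Y(3)])
      finally have "nrows f U {v \<in> V. x \<le> b v \<and> b v \<notin> insert y Y} \<le> h ^ Suc (Suc p)" by simp
      moreover have "card (insert y Y) \<le> Suc p" using Y by (simp add: card_insert_if)
      ultimately show ?thesis using Y(1) by blast
    qed
  qed
qed

context contraction_labelling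
begin

text \<open>For a block that violates the condition, the greedy cutting must yield \<open>p\<close>
  disjoint segments with more than \<open>h\<close> rows each; such blocks have been
  counted.\<close>

lemma card_blocks_without_few_rows:
  assumes b: "mono_on V b" "\<And>v. v \<in> V \<Longrightarrow> b v < n"
    and Q: "finite Q" "Q \<noteq> {}" "\<And>u w. u \<in> V \<Longrightarrow> w \<in> V \<Longrightarrow> f u w \<in> Q"
    and h: "D \<le> h" "card Q ^ D \<le> h"
    and k: "p \<le> k" "h ^ Suc p \<le> k"
  shows "p * card {a. a < n \<and> \<not> few_rows_outside V f b k a} \<le> rows_const D * n"
proof -
  let ?X = "{a. a < n \<and> \<not> few_rows_outside V f b k a}"
  have bn: "\<forall>v\<in>V. b v < n" using b(2) by blast
  have h1: "1 \<le> h" using h(1) D_pos by simp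
  have "\<exists>s e. (\<forall>i<p. e i < n \<and> h < nrows f (seg b a a) (seg b (s i) (e i))) \<and>
      (\<forall>i j. i < j \<longrightarrow> j < p \<longrightarrow> (e i :: nat) < s j)" if a: "a \<in> ?X" for a
  proof -
    have "seg b a a = {v \<in> V. b v = a}" by (auto simp: seg_def)
    then have "\<not> (\<exists>Y. finite Y \<and> card Y \<le> p \<and>
        nrows f (seg b a a) {v \<in> V. 0 \<le> b v \<and> b v \<notin> Y} \<le> h ^ Suc p)"
      using a k unfolding few_rows_outside_def by (auto dest: le_trans)
    note no = this
    have "\<exists>s e. (\<forall>i<p. 0 \<le> s i \<and> e i < n \<and> h < nrows f (seg b a a) (seg b (s i) (e i))) \<and>
        (\<forall>i j. i < j \<longrightarrow> j < p \<longrightarrow> (e i :: nat) < s j)"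
    proof (rule ccontr)
      assume none: "\<not> ?thesis"
      show False
        by (rule disjE[OF ex_segments_or_few_rows[of "seg b a a" V b n h p 0 f, folded seg_def,
            OF finite_sub[OF seg_subset] finite_V bn h1]])
          (erule notE[OF none], erule notE[OF no])
    qed
    then show ?thesis by simp
  qed
  then have "\<forall>a\<in>?X. \<exists>s e. (\<forall>i<p. e i < n \<and> h < nrows f (seg b a a) (seg b (s i) (e i))) \<and>
      (\<forall>i j. i < j \<longrightarrow> j < p \<longrightarrow> (e i :: nat) < s j)"
    by (rule ballI)
  from bchoice[OF this] obtain s where "\<forall>a\<in>?X. \<exists>e. (\<forall>i<p. e i < n \<and>
      h < nrows f (seg b a a) (seg b (s a i) (e i))) \<and> (\<forall>i j. i < j \<longrightarrow> j < p \<longrightarrow> (e i :: nat) < s a j)" ..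
  from bchoice[OF this] obtain e where se: "\<forall>a\<in>?X. (\<forall>i<p. e a i < n \<and> h < nrows f (seg b a a) (seg b (s a i) (e a i))) \<and>
      (\<forall>i j. i < j \<longrightarrow> j < p \<longrightarrow> (e a i :: nat) < s a j)" ..
  show ?thesis
  proof (rule card_blocks_with_many_complex_segments[OF b Q h, where s = s and e = e])
    fix a i assume a: "a \<in> ?X"
    show "e a i < n" "h < nrows f (seg b a a) (seg b (s a i) (e a i))" if "i < p"
      using bspec[OF se a] that by simp_all
    show "e a i < s a j" if "i < j" "j < p" for j using bspec[OF se a] that by simp
  qed auto
qed

end

subsection \<open>Matrices on an interval of positions\<close>

text \<open>The rows of \<open>M\<close> occupy the positions from \<open>off\<close> on, the columns those after the rows.\<close>

definition row_col_at :: "'a mat \<Rightarrow> nat \<Rightarrow> nat \<Rightarrow> nat + nat" where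
  "row_col_at M off p = (if p < off + dim_row M then Inl (p - off) else Inr (p - off - dim_row M))"

definition span :: "'a mat \<Rightarrow> nat \<Rightarrow> nat set" where
  "span M off = {off..<off + dim_row M + dim_col M}"

text \<open>Symmetric, so that rows and columns need no separate treatment, and \<open>None\<close>
  on all pairs that are not a row and a column of \<open>M\<close>. The offset lets the columns of
  one matrix and the rows of another occupy the same positions.\<close>

definition entry_at :: "'a mat \<Rightarrow> nat \<Rightarrow> nat \<Rightarrow> nat \<Rightarrow> 'a option" where
  "entry_at M off u v =
    (if off \<le> u \<and> u < off + dim_row M \<and> off + dim_row M \<le> v \<and> v < off + dim_row M + dim_col M
     then Some (M $$ (u - off, v - off - dim_row M))
     else if off \<le> v \<and> v < off + dim_row M \<and> off + dim_row M \<le> u \<and> u < off + dim_row M + dim_col M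
     then Some (M $$ (v - off, u - off - dim_row M)) else None)"

lemma entry_at_sym: "entry_at M off u v = entry_at M off v u"
  by (auto simp: entry_at_def)

lemma entry_at_outside: "u \<notin> span M off \<or> v \<notin> span M off \<Longrightarrow> entry_at M off u v = None"
  by (auto simp: entry_at_def span_def)

lemma entry_at_in: "entry_at M off u v \<in> insert None (Some ` elements_mat M)"
proof -
  have "M $$ (i, j) \<in> elements_mat M" if "i < dim_row M" "j < dim_col M" for i j
using that by (auto simp: elements_mat_def intro!: bexI[of _ i])
  then show ?thesis by (auto simp: entry_at_def intro!: imageI)
qed

lemma row_col_set_eq: "row_col_set M = row_col_at M off ` span M off"
proof
  show "row_col_set M \<subseteq> row_col_at M off ` span M off"
  proof
    fix x assume x: "x \<in> row_col_set M"
    then consider i where "x = Inl i" "i < dim_row M" | j where "x = Inr j" "j < dim_col M"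
      unfolding row_col_set_def by auto
    then show "x \<in> row_col_at M off ` span M off"
    proof cases
      case 1
      then show ?thesis
        by (intro image_eqI[of _ _ "off + i"]) (auto simp: row_col_at_def span_def)
    next
      case 2
      then show ?thesis
        by (intro image_eqI[of _ _ "off + dim_row M + j"]) (auto simp: row_col_at_def span_def)
    qed
  qed
qed (auto simp: row_col_set_def row_col_at_def span_def)

lemma inj_on_row_col_at: "inj_on (row_col_at M off) (span M off)"
  by (auto simp: inj_on_def row_col_at_def span_def split: if_splits)

lemma row_col_le_at:
  assumes "u \<in> span M off" "v \<in> span M off"
  shows "row_col_le (row_col_at M off u) (row_col_at M off v) \<longleftrightarrow> u \<le> v"
  using assms by (auto simp: row_col_at_def span_def)

lemma mat_structure_rels:
  "unary_rel (mat_structure M) P = Inl ` {..<dim_row M}"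
  "(x, y) \<in> binary_rel (mat_structure M) Leq \<longleftrightarrow>
    x \<in> row_col_set M \<and> y \<in> row_col_set M \<and> row_col_le x y"
  "(x, y) \<in> binary_rel (mat_structure M) (Entry a) \<longleftrightarrow>
    (\<exists>i j. x = Inl i \<and> y = Inr j \<and> i < dim_row M \<and> j < dim_col M \<and> M $$ (i, j) = a)"
  by (cases P; simp add: mat_structure_def)+

lemma atomic_type_mat_structure_eqD:
  assumes "atomic_type (mat_structure M) x y = atomic_type (mat_structure M) x' y'"
  shows "x \<in> Inl ` {..<dim_row M} \<longleftrightarrow> x' \<in> Inl ` {..<dim_row M}"
    "y \<in> Inl ` {..<dim_row M} \<longleftrightarrow> y' \<in> Inl ` {..<dim_row M}"
    "x \<in> row_col_set M \<and> y \<in> row_col_set M \<and> row_col_le x y \<longleftrightarrow>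
      x' \<in> row_col_set M \<and> y' \<in> row_col_set M \<and> row_col_le x' y'"
    "(\<exists>i j. x = Inl i \<and> y = Inr j \<and> i < dim_row M \<and> j < dim_col M \<and> M $$ (i, j) = a) \<longleftrightarrow>
      (\<exists>i j. x' = Inl i \<and> y' = Inr j \<and> i < dim_row M \<and> j < dim_col M \<and> M $$ (i, j) = a)"
    "(\<exists>i j. y = Inl i \<and> x = Inr j \<and> i < dim_row M \<and> j < dim_col M \<and> M $$ (i, j) = a) \<longleftrightarrow>
      (\<exists>i j. y' = Inl i \<and> x' = Inr j \<and> i < dim_row M \<and> j < dim_col M \<and> M $$ (i, j) = a)"
proof -
  note eq = assms[unfolded atomic_type_def prod.inject set_eq_iff mem_Collect_eq]
  show "x \<in> Inl ` {..<dim_row M} \<longleftrightarrow> x' \<in> Inl ` {..<dim_row M}"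
    using eq[THEN conjunct1] unfolding mat_structure_rels by blast
  show "y \<in> Inl ` {..<dim_row M} \<longleftrightarrow> y' \<in> Inl ` {..<dim_row M}"
    using eq[THEN conjunct2, THEN conjunct1] unfolding mat_structure_rels by blast
  note eq3 = eq[THEN conjunct2, THEN conjunct2, THEN conjunct1, rule_format]
    and eq4 = eq[THEN conjunct2, THEN conjunct2, THEN conjunct2, rule_format]
  show "x \<in> row_col_set M \<and> y \<in> row_col_set M \<and> row_col_le x y \<longleftrightarrow>
      x' \<in> row_col_set M \<and> y' \<in> row_col_set M \<and> row_col_le x' y'"
    using eq3[of Leq] unfolding mat_structure_rels .
  show "(\<exists>i j. x = Inl i \<and> y = Inr j \<and> i < dim_row M \<and> j < dim_col M \<and> M $$ (i, j) = a) \<longleftrightarrow>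
      (\<exists>i j. x' = Inl i \<and> y' = Inr j \<and> i < dim_row M \<and> j < dim_col M \<and> M $$ (i, j) = a)"
    using eq3[of "Entry a"] unfolding mat_structure_rels .
  show "(\<exists>i j. y = Inl i \<and> x = Inr j \<and> i < dim_row M \<and> j < dim_col M \<and> M $$ (i, j) = a) \<longleftrightarrow>
      (\<exists>i j. y' = Inl i \<and> x' = Inr j \<and> i < dim_row M \<and> j < dim_col M \<and> M $$ (i, j) = a)"
    using eq4[of "Entry a"] unfolding mat_structure_rels .
qed

lemma entry_at_eq_Some_iff:
  assumes "u \<in> span M off" "v \<in> span M off"
  shows "entry_at M off u v = Some a \<longleftrightarrow>
    (\<exists>i j. row_col_at M off u = Inl i \<and> row_col_at M off v = Inr j \<and> i < dim_row M \<and> j < dim_col M \<and> M $$ (i, j) = a) \<or>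
    (\<exists>i j. row_col_at M off v = Inl i \<and> row_col_at M off u = Inr j \<and> i < dim_row M \<and> j < dim_col M \<and> M $$ (i, j) = a)"
  using assms by (auto simp: entry_at_def span_def row_col_at_def)

lemma entry_at_eq_if_atomic_type_eq:
  assumes "u \<in> span M off" "v \<in> span M off" "u' \<in> span M off" "v' \<in> span M off"
    "atomic_type (mat_structure M) (row_col_at M off u) (row_col_at M off v) =
     atomic_type (mat_structure M) (row_col_at M off u') (row_col_at M off v')"
  shows "entry_at M off u v = entry_at M off u' v'"
proof -
  have "entry_at M off u v = Some a \<longleftrightarrow> entry_at M off u' v' = Some a" for a
    unfolding entry_at_eq_Some_iff[OF assms(1,2)] entry_at_eq_Some_iff[OF assms(3,4)]
      atomic_type_mat_structure_eqD(4,5)[OF assms(5)] ..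
  then show ?thesis by (metis option.exhaust)
qed

lemma finite_row_col_set: "finite (row_col_set M)"
  by (simp add: row_col_set_def)

lemma universe_mat_structure [simp]: "universe (mat_structure M) = row_col_set M"
  by (simp add: mat_structure_def)

section \<open>From an optimal contraction sequence to a labelling\<close>

lemma partition_on_contraction_sequence:
  assumes "contraction_sequence V Ps" "t < length Ps"
  shows "partition_on V (Ps ! t)"
  using assms(2)
proof (induction t)
  case 0
  then show ?case
    using assms(1) partition_on_singletons by (auto simp: contraction_sequence_def hd_conv_nth)
next
  case (Suc t)
  then have "merges (Ps ! t) (Ps ! Suc t)"
    using assms(1) by (auto simp: contraction_sequence_def successively_conv_nth)
  then obtain X Y where "X \<in> Ps ! t" "Y \<in> Ps ! t" "X \<noteq> Y"
    "Ps ! Suc t = insert (X \<union> Y) (Ps ! t - {X, Y})"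
    unfolding merges_def by blast
  then show ?case using partition_on_merge[of V "Ps ! t" X Y] Suc by simp
qed

text \<open>The degree is \<open>Suc (tww M)\<close> because \<open>near\<close> also counts the
  part itself.\<close>

lemma labelling_of_matrix:
  obtains T and lab :: "nat \<Rightarrow> nat \<Rightarrow> (nat + nat) set" and near where
    "contraction_labelling (span M off) T (Suc (tww M)) lab near (entry_at M off)"
proof -
  let ?S = "mat_structure M" and ?V = "span M off" and ?el = "row_col_at M off"
  have fin: "finite (universe ?S)" by (simp add: finite_row_col_set)
  obtain Ps where Ps: "contraction_sequence (universe ?S) Ps"
    "\<forall>P\<in>set Ps. \<forall>X\<in>P. card {Y \<in> P. red_adjacent ?S X Y} \<le> twin_width ?S"
    using obtain_optimal_contraction_sequence[OF fin] .
  define T where "T = length Ps - 1"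
  have ne: "Ps \<noteq> []" using Ps(1) by (simp add: contraction_sequence_def)
  have lt: "t < length Ps" if "t \<le> T" for t using that ne unfolding T_def by (cases Ps) auto
  have part: "partition_on (row_col_set M) (Ps ! t)" if "t \<le> T" for t
    using partition_on_contraction_sequence[OF Ps(1) lt[OF that]] by simp
  define lab where "lab t p = (THE X. X \<in> Ps ! t \<and> ?el p \<in> X)" for t p
  define near where "near t X Y \<longleftrightarrow> X = Y \<or> red_adjacent ?S X Y" for t :: nat and X Y
  have elV: "?el p \<in> row_col_set M" if "p \<in> ?V" for p using row_col_set_eq[of M off] that by auto
  have ex1: "\<exists>!X. X \<in> Ps ! t \<and> ?el p \<in> X" if t: "t \<le> T" and p: "p \<in> ?V" for t p
  proof -
    obtain X where "X \<in> Ps ! t" "?el p \<in> X"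
      using elV[OF p] partition_onD1[OF part[OF t]] by auto
    then show ?thesis using partition_onD2[OF part[OF t]] by (auto simp: disjoint_def)
  qed
  have lab: "lab t p \<in> Ps ! t" "?el p \<in> lab t p" if "t \<le> T" "p \<in> ?V" for t p
    using theI'[OF ex1[OF that]] unfolding lab_def by auto
  have labI: "lab t p = X" if "t \<le> T" "p \<in> ?V" "X \<in> Ps ! t" "?el p \<in> X" for t p X
    using the1_equality[OF ex1[OF that(1,2)]] that unfolding lab_def by blast
  have surj: "\<exists>p\<in>?V. lab t p = X" if t: "t \<le> T" and X: "X \<in> Ps ! t" for t X
  proof -
    have "X \<noteq> {}" "X \<subseteq> row_col_set M"
      using part[OF t] X by (auto simp: partition_on_def)
    then obtain p where "p \<in> ?V" "?el p \<in> X" using row_col_set_eq[of M off] by auto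
    then show ?thesis using labI[OF t _ X] by blast
  qed
  have finP: "finite (Ps ! t)" if "t \<le> T" for t
    using part[OF that] finite_row_col_set finite_elements by blast
  show ?thesis
  proof (rule that[of T lab near], unfold_locales)
    show "finite ?V" by (simp add: span_def)
    show "0 < Suc (tww M)" by simp
    show "near t k l \<Longrightarrow> near t l k" for t k l
      unfolding near_def using red_adjacent_sym by blast
  next
    fix t v assume t: "t \<le> T" and v: "v \<in> ?V"
    let ?R = "{Y \<in> Ps ! t. red_adjacent ?S (lab t v) Y}"
    have "{l \<in> lab t ` ?V. near t (lab t v) l} \<subseteq> insert (lab t v) ?R"
      using lab[OF t] by (auto simp: near_def)
    then have "card {l \<in> lab t ` ?V. near t (lab t v) l} \<le> card (insert (lab t v) ?R)"
      using finP[OF t] by (intro card_mono) auto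
    also have "\<dots> \<le> Suc (card ?R)" using finP[OF t] by (simp add: card_insert_if)
    also have "card ?R \<le> tww M"
      unfolding tww_def using Ps(2) lab(1)[OF t v] nth_mem[OF lt[OF t]] by blast
    finally show "card {l \<in> lab t ` ?V. near t (lab t v) l} \<le> Suc (tww M)" by simp
  next
    fix t x y z assume *: "t \<le> T" "x \<in> ?V" "y \<in> ?V" "z \<in> ?V" "x \<le> y" "y \<le> z" "lab t x = lab t z"
    show "near t (lab t x) (lab t y)"
    proof (cases "lab t x = lab t y")
      case False
      \<comment> \<open>\<open>x\<close> precedes \<open>y\<close> but \<open>z\<close> does not, so
        the relation \<open>Leq\<close> alone gives two different atomic types between the part of
        \<open>x\<close> and \<open>z\<close> and the part of \<open>y\<close>.\<close>
      then have "y \<noteq> z" using * by auto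
      then have "\<not> z \<le> y" using * by simp
      then have "\<not> row_col_le (?el z) (?el y)" "row_col_le (?el x) (?el y)"
        using row_col_le_at * by blast+
      then have "atomic_type ?S (?el x) (?el y) \<noteq> atomic_type ?S (?el z) (?el y)"
        using atomic_type_mat_structure_eqD(3)[of M "?el x" "?el y" "?el z" "?el y"] elV * by blast
      moreover have "?el x \<in> lab t x" "?el z \<in> lab t x" "?el y \<in> lab t y"
        using lab(2)[OF *(1)] * by metis+
      ultimately show ?thesis using False unfolding near_def red_adjacent_def by blast
    qed (simp add: near_def)
  next
    fix t u u' v v' assume *: "t \<le> T" "u \<in> ?V" "u' \<in> ?V" "v \<in> ?V" "v' \<in> ?V"
      "lab t u = lab t u'" "lab t v = lab t v'" "\<not> near t (lab t u) (lab t v)"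
    have "?el u \<in> lab t u" "?el u' \<in> lab t u" "?el v \<in> lab t v" "?el v' \<in> lab t v"
      using lab(2)[OF *(1)] * by metis+
    then have "atomic_type ?S (?el u) (?el v) = atomic_type ?S (?el u') (?el v')"
      using *(8) unfolding near_def red_adjacent_def by blast
    then show "entry_at M off u v = entry_at M off u' v'"
      by (rule entry_at_eq_if_atomic_type_eq[OF *(2,4,3,5)])
  next
    fix t assume t: "t < T"
    then have tT: "t \<le> T" "Suc t \<le> T" by auto
    have "merges (Ps ! t) (Ps ! Suc t)"
      using Ps(1) lt[OF tT(2)] by (auto simp: contraction_sequence_def successively_conv_nth)
    then obtain X Y where XY: "X \<in> Ps ! t" "Y \<in> Ps ! t" "X \<noteq> Y"
      "Ps ! Suc t = insert (X \<union> Y) (Ps ! t - {X, Y})"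
      unfolding merges_def by blast
    obtain x y where x: "x \<in> ?V" "lab t x = X" and y: "y \<in> ?V" "lab t y = Y"
      using surj[OF tT(1) XY(1)] surj[OF tT(1) XY(2)] by blast
    have new: "lab (Suc t) p = (if lab t p \<in> {X, Y} then X \<union> Y else lab t p)" if "p \<in> ?V" for p
      using lab[OF tT(1) that] XY by (intro labI[OF tT(2) that]) (auto split: if_splits)
    have XYnot: "lab t p \<noteq> X \<union> Y" if p: "p \<in> ?V" "lab t p \<notin> {X, Y}" for p
    proof
      assume eq: "lab t p = X \<union> Y"
      have "?el x \<in> lab t p" using lab(2)[OF tT(1) x(1)] x(2) unfolding eq by blast
      then show False using labI[OF tT(1) x(1) lab(1)[OF tT(1) p(1)]] x(2) p(2) by simp
    qed
    have "lab (Suc t) u = lab (Suc t) v \<longleftrightarrow>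
        lab t u = lab t v \<or> {lab t u, lab t v} = {lab t x, lab t y}"
      if u: "u \<in> ?V" and v: "v \<in> ?V" for u v
      unfolding new[OF u] new[OF v] x(2) y(2)
      using XYnot[OF u] XYnot[OF v] by (auto simp: doubleton_eq_iff)
    moreover have "lab t x \<noteq> lab t y" using x y XY(3) by simp
    ultimately show "\<exists>x\<in>?V. \<exists>y\<in>?V. lab t x \<noteq> lab t y \<and>
      (\<forall>u\<in>?V. \<forall>v\<in>?V. (lab (Suc t) u = lab (Suc t) v) =
        (lab t u = lab t v \<or> {lab t u, lab t v} = {lab t x, lab t y}))"
      using x(1) y(1) by (intro bexI[of _ x] bexI[of _ y]) simp_all
  next
    have P0: "Ps ! 0 = (\<lambda>v. {v}) ` row_col_set M"
      using Ps(1) ne by (simp add: contraction_sequence_def hd_conv_nth)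
    have "lab 0 p = {?el p}" if "p \<in> ?V" for p
      using elV[OF that] by (intro labI that) (auto simp: P0)
    then show "inj_on (lab 0) ?V"
      using inj_on_row_col_at[of M off] by (auto simp: inj_on_def)
  next
    fix u v assume uv: "u \<in> ?V" "v \<in> ?V"
    have PT: "Ps ! T \<subseteq> {row_col_set M}"
      using Ps(1) ne by (simp add: contraction_sequence_def last_conv_nth T_def)
    show "lab T u = lab T v" using lab(1)[OF order_refl uv(1)] lab(1)[OF order_refl uv(2)] PT by auto
  qed
qed

subsection \<open>Merging blocks for both matrices at once\<close>

text \<open>With \<open>p = 8 * rows_const D\<close>, the estimate on \<open>p\<close> times the
  number of bad blocks leaves at most an eighth of the blocks. The sum dominates both
  \<open>p\<close> and \<open>h ^ Suc p\<close> for \<open>h = D + c ^ D\<close>, where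
  \<open>c\<close> is the number of colours.\<close>

definition row_bound :: "nat \<Rightarrow> nat \<Rightarrow> nat" where
  "row_bound D c = 8 * rows_const D + (D + c ^ D) ^ Suc (8 * rows_const D)"

lemma card_blocks_without_few_rows_mat:
  assumes "finite S" "elements_mat M \<subseteq> S" "mono_on (span M off) b"
    "\<And>v. v \<in> span M off \<Longrightarrow> b v < n"
  shows "8 * card {a. a < n \<and> \<not> few_rows_outside (span M off) (entry_at M off) b
    (row_bound (Suc (tww M)) (Suc (card S))) a} \<le> n"
proof -
  let ?D = "Suc (tww M)" and ?Q = "insert None (Some ` S)"
  obtain T lab near where "contraction_labelling (span M off) T ?D
      (lab :: nat \<Rightarrow> nat \<Rightarrow> (nat + nat) set) near (entry_at M off)"
    by (rule labelling_of_matrix)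
  then interpret contraction_labelling "span M off" T ?D lab near "entry_at M off" .
  have cQ: "card ?Q = Suc (card S)" using assms(1) by (simp add: card_image)
  let ?k = "row_bound ?D (Suc (card S))"
  have "8 * rows_const ?D * card {a. a < n \<and> \<not> few_rows_outside (span M off) (entry_at M off) b ?k a}
      \<le> rows_const ?D * n"
  proof (rule card_blocks_without_few_rows[OF assms(3,4), where Q = ?Q and h = "?D + Suc (card S) ^ ?D"])
    show "entry_at M off u w \<in> ?Q" for u w using entry_at_in[of M off u w] assms(2) by auto
  qed (use assms(1) in \<open>auto simp: cQ row_bound_def simp del: power_Suc\<close>)
  moreover have "0 < rows_const ?D" by (simp add: rows_const_def)
  ultimately show ?thesis by (simp only: mult.assoc mult.left_commute[of 8] nat_mult_le_cancel1)
qed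

lemma nrows_Pair_le:
  assumes "finite U"
  shows "nrows (\<lambda>u v. (f u v, g u v)) U W \<le> nrows f U W * nrows g U W"
proof -
  let ?r = "\<lambda>f u. restrict (f u) W"
  have "nrows (\<lambda>u v. (f u v, g u v)) U W \<le> card ((\<lambda>u. (?r f u, ?r g u)) ` U)"
  proof (rule nrows_le_if_determined)
    fix u v w assume w: "w \<in> W" and "(?r f u, ?r g u) = (?r f v, ?r g v)"
    then have "?r f u w = ?r f v w" "?r g u w = ?r g v w" by simp_all
    then show "(f u w, g u w) = (f v w, g v w)" using w by simp
  qed (use assms in simp)
  also have "\<dots> \<le> card (?r f ` U \<times> ?r g ` U)"
    using assms by (intro card_mono) auto
  also have "\<dots> = nrows f U W * nrows g U W" by (simp add: nrows_def card_cartesian_product)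
  finally show ?thesis .
qed

text \<open>Columns outside \<open>V\<close> show only \<open>None\<close>, and the elements outside
  \<open>V\<close> all have the same constant row: one additional row.\<close>

lemma nrows_extend_None_le:
  assumes "finite U" "\<And>u v. u \<notin> V \<or> v \<notin> V \<Longrightarrow> f u v = None"
  shows "nrows f U W \<le> Suc (nrows f (U \<inter> V) (W \<inter> V))"
proof -
  define key where "key u = (if u \<in> V then Some (restrict (f u) (W \<inter> V)) else None)" for u
  have "nrows f U W \<le> card (key ` U)"
  proof (rule nrows_le_if_determined)
    fix u v w assume w: "w \<in> W" and eq: "key u = key v"
    show "f u w = f v w"
    proof (cases "u \<in> V \<and> w \<in> V")
      case True
      then have "restrict (f u) (W \<inter> V) = restrict (f v) (W \<inter> V)"
        using eq by (simp add: key_def split: if_splits)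
      from fun_cong[OF this, of w] show ?thesis using True w by simp
    next
      case False
      then have "f u w = None" using assms(2) by blast
      moreover have "v \<notin> V \<or> w \<notin> V" using False eq by (auto simp: key_def split: if_splits)
      then have "f v w = None" using assms(2) by blast
      ultimately show ?thesis by simp
    qed
  qed (use assms in simp)
  also have "\<dots> \<le> card (insert None (Some ` (\<lambda>u. restrict (f u) (W \<inter> V)) ` (U \<inter> V)))"
    using assms(1) by (intro card_mono) (auto simp: key_def)
  also have "\<dots> \<le> Suc (card (Some ` (\<lambda>u. restrict (f u) (W \<inter> V)) ` (U \<inter> V)))"
    using assms(1) by (simp add: card_insert_if)
  also have "card (Some ` (\<lambda>u. restrict (f u) (W \<inter> V)) ` (U \<inter> V)) = nrows f (U \<inter> V) (W \<inter> V)"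
    unfolding nrows_def by (intro card_image) simp
  finally show ?thesis by simp
qed

text \<open>Exceptional blocks are united and row counts multiplied. The \<open>Suc\<close> on each
  factor is the constant row of the positions outside that matrix.\<close>

lemma few_rows_outside_Pair:
  assumes fin: "finite V1" "finite V2"
    and none: "\<And>u v. u \<notin> V1 \<or> v \<notin> V1 \<Longrightarrow> f u v = None" "\<And>u v. u \<notin> V2 \<or> v \<notin> V2 \<Longrightarrow> g u v = None"
    and few: "few_rows_outside V1 f b k a" "few_rows_outside V2 g b l a"
  shows "few_rows_outside (V1 \<union> V2) (\<lambda>u v. (f u v, g u v)) b (Suc k * Suc l) a"
proof -
  obtain Y where Y: "finite Y" "card Y \<le> k" "nrows f {v \<in> V1. b v = a} {w \<in> V1. b w \<notin> Y} \<le> k"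
    using few(1) unfolding few_rows_outside_def by auto
  obtain Z where Z: "finite Z" "card Z \<le> l" "nrows g {v \<in> V2. b v = a} {w \<in> V2. b w \<notin> Z} \<le> l"
    using few(2) unfolding few_rows_outside_def by auto
  let ?U = "{v \<in> V1 \<union> V2. b v = a}" and ?W = "{w \<in> V1 \<union> V2. b w \<notin> Y \<union> Z}"
  have finU: "finite ?U" using fin by simp
  have "nrows f (?U \<inter> V1) (?W \<inter> V1) \<le> nrows f {v \<in> V1. b v = a} {w \<in> V1. b w \<notin> Y}"
    using fin by (intro nrows_mono) auto
  moreover have "nrows f ?U ?W \<le> Suc (nrows f (?U \<inter> V1) (?W \<inter> V1))"
    using finU by (rule nrows_extend_None_le[of ?U V1 f ?W]) (rule none(1))
  ultimately have 1: "nrows f ?U ?W \<le> Suc k" using Y(3) by linarith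
  have "nrows g (?U \<inter> V2) (?W \<inter> V2) \<le> nrows g {v \<in> V2. b v = a} {w \<in> V2. b w \<notin> Z}"
    using fin by (intro nrows_mono) auto
  moreover have "nrows g ?U ?W \<le> Suc (nrows g (?U \<inter> V2) (?W \<inter> V2))"
    using finU by (rule nrows_extend_None_le[of ?U V2 g ?W]) (rule none(2))
  ultimately have 2: "nrows g ?U ?W \<le> Suc l" using Z(3) by linarith
  have "nrows (\<lambda>u v. (f u v, g u v)) ?U ?W \<le> Suc k * Suc l"
    using nrows_Pair_le[OF finU, of f g ?W] mult_le_mono[OF 1 2] by linarith
  moreover have "card (Y \<union> Z) \<le> Suc k * Suc l"
    using card_Un_le[of Y Z] Y(2) Z(2) by simp
  ultimately show ?thesis
    unfolding few_rows_outside_def using Y(1) Z(1) by (intro exI[of _ "Y \<union> Z"]) simp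
qed

definition merge_at :: "nat \<Rightarrow> nat \<Rightarrow> nat" where
  "merge_at l x = (if x \<le> l then x else x - 1)"

text \<open>The pairs of consecutive blocks form a division of half the size, in which most blocks have few
  rows. Undoing all but one of the pairings at most doubles the number of exceptional blocks.\<close>

lemma ex_merge_keeping_few_rows:
  assumes "finite V" "2 \<le> n" "\<And>v. v \<in> V \<Longrightarrow> b v < n"
    and most: "4 * card {a. a < (n + 1) div 2 \<and> \<not> few_rows_outside V f (\<lambda>v. b v div 2) k a} \<le> (n + 1) div 2"
    and all: "\<And>a. a < n \<Longrightarrow> few_rows_outside V f b (2 * k) a"
  shows "\<exists>l. Suc l < n \<and> (\<forall>a < n - 1. few_rows_outside V f (\<lambda>v. merge_at l (b v)) (2 * k) a)"
proof -
  let ?bad = "{a. a < (n + 1) div 2 \<and> \<not> few_rows_outside V f (\<lambda>v. b v div 2) k a}"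
  \<comment> \<open>The bound \<open>n div 2\<close> ensures that both blocks \<open>2 * c\<close>
    and \<open>2 * c + 1\<close> exist; for odd \<open>n\<close> the last block of the halved
    division is unpaired.\<close>
  have "\<exists>c. c < n div 2 \<and> c \<notin> ?bad"
  proof (rule ccontr)
    assume "\<not> ?thesis"
    then have "{..<n div 2} \<subseteq> ?bad" by auto
    then have "card {..<n div 2} \<le> card ?bad" by (rule card_mono[rotated]) simp
    then have "4 * (n div 2) \<le> (n + 1) div 2" using most by simp
    then show False using assms(2) by linarith
  qed
  then obtain c where c: "c < n div 2" "few_rows_outside V f (\<lambda>v. b v div 2) k c"
    by auto
  let ?b = "\<lambda>v. merge_at (2 * c) (b v)"
  have "few_rows_outside V f ?b (2 * k) a" if a: "a < n - 1" for a
  proof (cases "a = 2 * c")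
    case True
    obtain Y where Y: "finite Y" "card Y \<le> k"
      "nrows f {v \<in> V. b v div 2 = c} {w \<in> V. b w div 2 \<notin> Y} \<le> k"
      using c(2) unfolding few_rows_outside_def by auto
    \<comment> \<open>Every exceptional pair \<open>y\<close> opens up into two blocks, the source
      of the factor 2 in the invariant.\<close>
    let ?Y = "merge_at (2 * c) ` (\<Union>y\<in>Y. {2 * y, 2 * y + 1})"
    have "card ?Y \<le> card (\<Union>y\<in>Y. {2 * y, 2 * y + 1})" using Y(1) by (intro card_image_le) auto
    also have "\<dots> \<le> card Y * 2" using Y(1) by (rule card_UN_le_mult) simp
    finally have cY: "card ?Y \<le> 2 * k" using Y(2) by simp
    have "{v \<in> V. ?b v = a} \<subseteq> {v \<in> V. b v div 2 = c}"
      unfolding True by (auto simp: merge_at_def split: if_splits)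
    moreover have "{w \<in> V. ?b w \<notin> ?Y} \<subseteq> {w \<in> V. b w div 2 \<notin> Y}"
    proof
      fix w assume w: "w \<in> {w \<in> V. ?b w \<notin> ?Y}"
      have "b w div 2 \<notin> Y"
      proof
        assume "b w div 2 \<in> Y"
        moreover have "b w \<in> {2 * (b w div 2), 2 * (b w div 2) + 1}" by auto
        ultimately have "?b w \<in> ?Y" by blast
        then show False using w by blast
      qed
      then show "w \<in> {w \<in> V. b w div 2 \<notin> Y}" using w by blast
    qed
    ultimately have "nrows f {v \<in> V. ?b v = a} {w \<in> V. ?b w \<notin> ?Y}
        \<le> nrows f {v \<in> V. b v div 2 = c} {w \<in> V. b w div 2 \<notin> Y}"
      using assms(1) by (intro nrows_mono) auto
    then have "nrows f {v \<in> V. ?b v = a} {w \<in> V. ?b w \<notin> ?Y} \<le> 2 * k" using Y(3) by simp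
    then show ?thesis unfolding few_rows_outside_def using cY Y(1) by (intro exI[of _ ?Y]) simp
  next
    case False
    \<comment> \<open>The number of this block before the merge. Its exceptional set is only mapped
      forward and does not grow, so the bound is inherited unchanged.\<close>
    define a0 where "a0 = (if a < 2 * c then a else a + 1)"
    have "a0 < n" using a by (auto simp: a0_def)
    then obtain Y where Y: "finite Y" "card Y \<le> 2 * k"
      "nrows f {v \<in> V. b v = a0} {w \<in> V. b w \<notin> Y} \<le> 2 * k"
      using all unfolding few_rows_outside_def by blast
    let ?Y = "merge_at (2 * c) ` Y"
    have "card ?Y \<le> 2 * k" using card_image_le[OF Y(1), of "merge_at (2 * c)"] Y(2) by simp
    moreover have "nrows f {v \<in> V. ?b v = a} {w \<in> V. ?b w \<notin> ?Y}
        \<le> nrows f {v \<in> V. b v = a0} {w \<in> V. b w \<notin> Y}"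
      using assms(1) False by (intro nrows_mono) (auto simp: a0_def merge_at_def split: if_splits)
    ultimately show ?thesis
      unfolding few_rows_outside_def using Y(1,3) by (intro exI[of _ ?Y]) simp
  qed
  moreover have "Suc (2 * c) < n" using c(1) by linarith
  ultimately show ?thesis by blast
qed

subsection \<open>Classes of a division\<close>

lemma nrows_UN_le:
  assumes "finite I" "finite U" "\<And>i. i \<in> I \<Longrightarrow> nrows f U (W i) \<le> h"
  shows "nrows f U (\<Union>i\<in>I. W i) \<le> h ^ card I"
  using assms(1,3)
proof (induction I)
  case empty
  then show ?case using nrows_empty_le[OF assms(2)] by simp
next
  case (insert i I)
  have "nrows f U (\<Union>j\<in>insert i I. W j) \<le> nrows f U (W i) * nrows f U (\<Union>j\<in>I. W j)"
    using nrows_Un_le[OF assms(2), of f "W i" "\<Union>j\<in>I. W j"] by simp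
  also have "\<dots> \<le> h * h ^ card I" using insert by (intro mult_le_mono) auto
  finally show ?case using insert by simp
qed

text \<open>Both directions are tested since a cell with few distinct rows may have exponentially
  more distinct columns. The relation becomes symmetric.\<close>

definition complex_blocks ::
  "nat set \<Rightarrow> (nat \<Rightarrow> nat \<Rightarrow> 'c) \<Rightarrow> nat \<Rightarrow> (nat \<Rightarrow> nat) \<Rightarrow> nat \<Rightarrow> nat \<Rightarrow> bool" where
  "complex_blocks V f h b x y \<longleftrightarrow>
    h < nrows f {v \<in> V. b v = x} {v \<in> V. b v = y} \<or> h < nrows f {v \<in> V. b v = y} {v \<in> V. b v = x}"

text \<open>The type of \<open>u\<close>: its row with the entries in complex cells hidden by
  \<open>None\<close>. Hiding them is what keeps the number of types in a block bounded.\<close>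

definition block_key ::
  "nat set \<Rightarrow> (nat \<Rightarrow> nat \<Rightarrow> 'c) \<Rightarrow> nat \<Rightarrow> (nat \<Rightarrow> nat) \<Rightarrow> nat \<Rightarrow> nat \<times> (nat \<Rightarrow> 'c option)" where
  "block_key V f h b u =
    (b u, \<lambda>w. if w \<in> V \<and> \<not> complex_blocks V f h b (b u) (b w) then Some (f u w) else None)"

lemma complex_blocks_sym: "complex_blocks V f h b x y \<longleftrightarrow> complex_blocks V f h b y x"
  unfolding complex_blocks_def by blast

lemma block_keyD:
  assumes "block_key V f h b u = block_key V f h b v"
  shows "b u = b v"
    "w \<in> V \<Longrightarrow> \<not> complex_blocks V f h b (b u) (b w) \<Longrightarrow> f u w = f v w"
proof -
  show "b u = b v" using assms unfolding block_key_def by simp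
  assume w: "w \<in> V" "\<not> complex_blocks V f h b (b u) (b w)"
  have "snd (block_key V f h b u) w = snd (block_key V f h b v) w" using assms by simp
  then show "f u w = f v w" using w \<open>b u = b v\<close> unfolding block_key_def by simp
qed

lemma block_keyI:
  assumes "b u = b v" "\<And>w. w \<in> V \<Longrightarrow> \<not> complex_blocks V f h b (b u) (b w) \<Longrightarrow> f u w = f v w"
  shows "block_key V f h b u = block_key V f h b v"
  unfolding block_key_def using assms by (auto simp: fun_eq_iff)

lemma complex_blocks_coarsen:
  assumes "finite V" "\<And>u v. u \<in> V \<Longrightarrow> v \<in> V \<Longrightarrow> b u = b v \<Longrightarrow> b' u = b' v"
    "u \<in> V" "w \<in> V" "complex_blocks V f h b (b u) (b w)"
  shows "complex_blocks V f h b' (b' u) (b' w)"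
proof -
  have sub: "{v \<in> V. b v = b x} \<subseteq> {v \<in> V. b' v = b' x}" if "x \<in> V" for x
    using assms(2) that by blast
  have "nrows f {v \<in> V. b v = b x} {v \<in> V. b v = b y} \<le> nrows f {v \<in> V. b' v = b' x} {v \<in> V. b' v = b' y}"
    if "x \<in> V" "y \<in> V" for x y
    using sub[OF that(1)] sub[OF that(2)] assms(1) by (intro nrows_mono) auto
  from this[OF assms(3,4)] this[OF assms(4,3)] show ?thesis
    using assms(5) unfolding complex_blocks_def by linarith
qed

text \<open>A cell that is simple after merging was simple before, so the new key reads no entry
  that the old one hides. Hence classes only get coarser although the set of complex cells changes
  as well.\<close>

lemma block_key_coarsen:
  assumes "finite V" "\<And>u v. u \<in> V \<Longrightarrow> v \<in> V \<Longrightarrow> b u = b v \<Longrightarrow> b' u = b' v"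
    "u \<in> V" "v \<in> V" "block_key V f h b u = block_key V f h b v"
  shows "block_key V f h b' u = block_key V f h b' v"
proof (rule block_keyI)
  show "b' u = b' v" using assms block_keyD(1)[OF assms(5)] by blast
  fix w assume w: "w \<in> V" "\<not> complex_blocks V f h b' (b' u) (b' w)"
  have "\<not> complex_blocks V f h b (b u) (b w)"
    using complex_blocks_coarsen[of V b b' u w f h, OF assms(1,2,3) w(1)] w(2) by blast
  then show "f u w = f v w" by (rule block_keyD(2)[OF assms(5) w(1)])
qed

text \<open>A cell outside the exceptional blocks has few rows, hence few columns, so that the symmetric
  complexity relation has bounded degree.\<close>

locale few_rows_division =
  fixes V :: "nat set" and f :: "nat \<Rightarrow> nat \<Rightarrow> 'c" and b :: "nat \<Rightarrow> nat" and n k h :: nat and Q :: "'c set"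
  assumes finite_V: "finite V"
    and sym: "f u v = f v u"
    and Q: "finite Q" "Q \<noteq> {}" "f u v \<in> Q"
    and b_less: "v \<in> V \<Longrightarrow> b v < n"
    and few: "a < n \<Longrightarrow> few_rows_outside V f b k a"
    and h_def: "h = k + card Q ^ k"
begin

lemma finite_block: "finite {v \<in> V. P v}"
  using finite_V by simp

lemma h_pos: "1 \<le> h"
  using Q unfolding h_def by (simp add: Suc_le_eq card_gt_0_iff)

lemma block_empty: "n \<le> a \<Longrightarrow> {v \<in> V. b v = a} = {}"
  using b_less by force

lemma nrows_transpose_le:
  assumes "U \<subseteq> V" "W \<subseteq> V" "nrows f U W \<le> k"
  shows "nrows f W U \<le> h"
proof -
  have fin: "finite U" "finite W" using assms finite_V finite_subset by auto
  have "nrows f W U \<le> card Q ^ k"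
  proof (rule nrows_le_power[where g = "\<lambda>u. restrict (f u) W"])
    show "card ((\<lambda>u. restrict (f u) W) ` U) \<le> k" using assms(3) by (simp add: nrows_def)
    fix w u u' assume w: "w \<in> W" and "restrict (f u) W = restrict (f u') W"
    from fun_cong[OF this(2), of w] show "f w u = f w u'" using w sym by simp
  qed (use fin Q in auto)
  then show ?thesis unfolding h_def by simp
qed

lemma ex_complex_cover:
  "\<exists>Y. finite Y \<and> card Y \<le> k \<and> {c. complex_blocks V f h b a c} \<subseteq> Y \<and>
    nrows f {v \<in> V. b v = a} {w \<in> V. b w \<notin> Y} \<le> k"
proof (cases "a < n")
  case True
  obtain Y where Y: "finite Y" "card Y \<le> k" "nrows f {v \<in> V. b v = a} {w \<in> V. b w \<notin> Y} \<le> k"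
    using few[OF True] unfolding few_rows_outside_def by blast
  have "c \<in> Y" if c: "complex_blocks V f h b a c" for c
  proof (rule ccontr)
    assume "c \<notin> Y"
    then have "nrows f {v \<in> V. b v = a} {w \<in> V. b w = c} \<le> nrows f {v \<in> V. b v = a} {w \<in> V. b w \<notin> Y}"
      using finite_V by (intro nrows_mono) auto
    then have le: "nrows f {v \<in> V. b v = a} {w \<in> V. b w = c} \<le> k" using Y(3) by linarith
    then have "nrows f {w \<in> V. b w = c} {v \<in> V. b v = a} \<le> h"
      by (rule nrows_transpose_le[rotated 2]) auto
    then show False using c le unfolding complex_blocks_def h_def by linarith
  qed
  then show ?thesis using Y by blast
next
  case False
  then have e: "{v \<in> V. b v = a} = {}" using block_empty by simp
  have "\<not> complex_blocks V f h b a c" for c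
    using nrows_empty_le[OF finite_block, of f "\<lambda>v. b v = c"] h_pos
    unfolding complex_blocks_def e by (simp add: nrows_def)
  then show ?thesis unfolding e by (intro exI[of _ "{}"]) (auto simp: nrows_def)
qed

lemma finite_complex: "finite {c. complex_blocks V f h b a c}"
  using ex_complex_cover[of a] finite_subset by blast

lemma card_complex_le: "card {c. complex_blocks V f h b a c} \<le> k"
  using ex_complex_cover[of a] by (meson card_mono le_trans)

text \<open>Outside the exceptional blocks there are at most \<open>k\<close> rows; each of the at
  most \<open>k\<close> exceptional blocks whose cell is simple contributes a factor
  \<open>h\<close>.\<close>

lemma card_block_keys_le: "card (block_key V f h b ` {v \<in> V. b v = a}) \<le> k * h ^ k"
proof -
  let ?U = "{v \<in> V. b v = a}" and ?W = "{w \<in> V. \<not> complex_blocks V f h b a (b w)}"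
  obtain Y where Y: "finite Y" "card Y \<le> k" "{c. complex_blocks V f h b a c} \<subseteq> Y"
    "nrows f ?U {w \<in> V. b w \<notin> Y} \<le> k"
    using ex_complex_cover[of a] by blast
  let ?I = "{y \<in> Y. \<not> complex_blocks V f h b a y}"
  have "card (block_key V f h b ` ?U) \<le> card ((\<lambda>u. restrict (f u) ?W) ` ?U)"
  proof (rule card_image_le_if_determined)
    fix u v assume uv: "u \<in> ?U" "v \<in> ?U" and eq: "restrict (f u) ?W = restrict (f v) ?W"
    show "block_key V f h b u = block_key V f h b v"
    proof (rule block_keyI)
      show "b u = b v" using uv by simp
      fix w assume "w \<in> V" "\<not> complex_blocks V f h b (b u) (b w)"
      then have "w \<in> ?W" using uv by simp
      then show "f u w = f v w" using fun_cong[OF eq, of w] by simp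
    qed
  qed (use finite_V in simp)
  also have "\<dots> = nrows f ?U ?W" by (simp add: nrows_def)
  also have "\<dots> \<le> nrows f ?U ({w \<in> V. b w \<notin> Y} \<union> (\<Union>y\<in>?I. {w \<in> V. b w = y}))"
    using finite_V by (intro nrows_mono) auto
  also have "\<dots> \<le> nrows f ?U {w \<in> V. b w \<notin> Y} * nrows f ?U (\<Union>y\<in>?I. {w \<in> V. b w = y})"
    by (rule nrows_Un_le[OF finite_block])
  also have "\<dots> \<le> k * h ^ card ?I"
  proof (intro mult_le_mono Y(4) nrows_UN_le finite_block)
    show "finite ?I" using Y(1) by simp
    show "nrows f ?U {w \<in> V. b w = y} \<le> h" if "y \<in> ?I" for y
      using that unfolding complex_blocks_def by simp
  qed
  also have "\<dots> \<le> k * h ^ k"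
  proof (intro mult_le_mono2 power_increasing h_pos)
    have "card ?I \<le> card Y" using Y(1) by (intro card_mono) auto
    then show "card ?I \<le> k" using Y(2) by simp
  qed
  finally show ?thesis .
qed

end

lemma (in abelian_monoid) finsum_eq_if_fibre_sums_eq:
  assumes "finite K" "g \<in> K \<rightarrow> carrier G" "g' \<in> K \<rightarrow> carrier G"
    "\<And>y. finsum G g {x \<in> K. \<kappa> x = y} = finsum G g' {x \<in> K. \<kappa> x = y}"
  shows "finsum G g K = finsum G g' K"
proof -
  have split: "finsum G g K = finsum G (\<lambda>y. finsum G g {x \<in> K. \<kappa> x = y}) (\<kappa> ` K)"
    if "g \<in> K \<rightarrow> carrier G" for g
  proof -
    have K: "K = (\<Union>y\<in>\<kappa> ` K. {x \<in> K. \<kappa> x = y})" by auto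
    have "finsum G g (\<Union>y\<in>\<kappa> ` K. {x \<in> K. \<kappa> x = y}) =
        finsum G (\<lambda>y. finsum G g {x \<in> K. \<kappa> x = y}) (\<kappa> ` K)"
      using assms(1) that
      by (intro add.finprod_UN_disjoint) (auto simp: pairwise_def disjnt_def)
    then show ?thesis using K by simp
  qed
  show ?thesis unfolding split[OF assms(2)] split[OF assms(3)] assms(4) ..
qed

subsection \<open>The matrix product\<close>

definition fibres :: "('a \<Rightarrow> 'b) \<Rightarrow> 'a set \<Rightarrow> 'a set set" where
  "fibres \<kappa> U = (\<lambda>x. {y \<in> U. \<kappa> y = \<kappa> x}) ` U"

lemma partition_on_fibres: "partition_on U (fibres \<kappa> U)"
  by (auto simp: partition_on_def disjoint_def fibres_def)

lemma refines_fibres: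
  assumes "\<And>x y. x \<in> U \<Longrightarrow> y \<in> U \<Longrightarrow> \<kappa> x = \<kappa> y \<Longrightarrow> \<kappa>' x = \<kappa>' y"
  shows "refines U (fibres \<kappa> U) (fibres \<kappa>' U)"
  unfolding refines_def
proof (intro conjI partition_on_fibres ballI)
  fix X assume "X \<in> fibres \<kappa> U"
  then obtain x where x: "x \<in> U" "X = {y \<in> U. \<kappa> y = \<kappa> x}" unfolding fibres_def by blast
  have "X \<subseteq> {y \<in> U. \<kappa>' y = \<kappa>' x}"
  proof
    fix y assume "y \<in> X"
    then have y: "y \<in> U" "\<kappa> y = \<kappa> x" using x(2) by simp_all
    show "y \<in> {y \<in> U. \<kappa>' y = \<kappa>' x}" using assms[OF y(1) x(1) y(2)] y(1) by simp
  qed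
  moreover have "{y \<in> U. \<kappa>' y = \<kappa>' x} \<in> fibres \<kappa>' U" using x unfolding fibres_def by blast
  ultimately show "\<exists>Z\<in>fibres \<kappa>' U. X \<subseteq> Z" by blast
qed

lemma card_fibres_within_le:
  assumes "finite Z"
  shows "card {X \<in> fibres \<kappa> U. X \<subseteq> Z} \<le> card (\<kappa> ` Z)"
proof -
  have "{X \<in> fibres \<kappa> U. X \<subseteq> Z} \<subseteq> (\<lambda>c. {y \<in> U. \<kappa> y = c}) ` \<kappa> ` Z"
  proof
    fix X assume X: "X \<in> {X \<in> fibres \<kappa> U. X \<subseteq> Z}"
    then obtain x where x: "x \<in> U" "X = {y \<in> U. \<kappa> y = \<kappa> x}" unfolding fibres_def by blast
    then have "x \<in> Z" using X by blast
    then show "X \<in> (\<lambda>c. {y \<in> U. \<kappa> y = c}) ` \<kappa> ` Z" using x by blast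
  qed
  then have "card {X \<in> fibres \<kappa> U. X \<subseteq> Z} \<le> card ((\<lambda>c. {y \<in> U. \<kappa> y = c}) ` \<kappa> ` Z)"
    using assms by (intro card_mono) auto
  also have "\<dots> \<le> card (\<kappa> ` Z)" using assms by (intro card_image_le) auto
  finally show ?thesis .
qed

text \<open>The 2 separates rows from columns of the product, \<open>k * h ^ k\<close> bounds the
  types in a block. The exponent bounds the inner classes in its at most \<open>k\<close> complex
  cells, each of which has a sum with \<open>q\<close> possible values.\<close>

definition key_bound :: "nat \<Rightarrow> nat \<Rightarrow> nat \<Rightarrow> nat" where
  "key_bound k h q = 2 * (k * h ^ k * q ^ (k * (k * h ^ k)))"

locale conformal_matrices = field F for F (structure) +
  fixes A B :: "'a mat"
  assumes A_in: "elements_mat A \<subseteq> carrier F"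
    and B_in: "elements_mat B \<subseteq> carrier F"
    and conformal: "dim_col A = dim_row B"
    and fin_F: "finite (carrier F)"
begin

abbreviation "m \<equiv> dim_row A"
abbreviation "n \<equiv> dim_row B"
abbreviation "l \<equiv> dim_col B"
abbreviation "AB \<equiv> mat_mult_over F A B"
abbreviation "V \<equiv> {..<m + n + l}"

text \<open>Positions: rows of \<open>A\<close> below \<open>m\<close>, inner indices from \<open>m\<close> on, columns of \<open>B\<close> from \<open>m + n\<close> on. For a
  row or column \<open>u\<close> of the product, \<open>val u k\<close> is its entry at the inner index \<open>k\<close>.\<close>

definition ent :: "nat \<Rightarrow> nat \<Rightarrow> 'a option \<times> 'a option" where
  "ent u v = (entry_at A 0 u v, entry_at B m u v)"

definition val :: "nat \<Rightarrow> nat \<Rightarrow> 'a" where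
  "val u k = (if u < m then A $$ (u, k) else B $$ (k, u - m - n))"

definition outer :: "nat set" where
  "outer = {..<m} \<union> {m + n..<m + n + l}"

text \<open>One block may contain both rows and columns, hence the component \<open>u < m\<close>.
  The sums are what remains of a product entry once the other factor, constant on the class, is
  pulled out.\<close>

definition key where
  "key h b u = (u < m, block_key V ent h b u,
    \<lambda>y. finsum F (val u) {k \<in> {..<n}. block_key V ent h b (m + k) = y})"

definition pos :: "nat + nat \<Rightarrow> nat" where
  "pos x = (case x of Inl i \<Rightarrow> i | Inr j \<Rightarrow> m + n + j)"

definition colours :: "('a option \<times> 'a option) set" where
  "colours = insert None (Some ` carrier F) \<times> insert None (Some ` carrier F)"

lemma outer_subset: "outer \<subseteq> V"
  unfolding outer_def by auto

lemma val_in: "u \<in> outer \<Longrightarrow> k < n \<Longrightarrow> val u k \<in> carrier F"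
proof -
  assume u: "u \<in> outer" and k: "k < n"
  have "val u k \<in> elements_mat A \<union> elements_mat B"
  proof (cases "u < m")
    case True
    then have "A $$ (u, k) \<in> elements_mat A"
      using k conformal by (auto simp: elements_mat_def intro!: bexI[of _ u])
    then show ?thesis using True by (simp add: val_def)
  next
    case False
    then have "u - m - n < l" using u unfolding outer_def by auto
    then have "B $$ (k, u - m - n) \<in> elements_mat B"
      using k by (auto simp: elements_mat_def intro!: bexI[of _ k])
    then show ?thesis using False by (simp add: val_def)
  qed
  then show ?thesis using A_in B_in by blast
qed

lemma val_fun: "u \<in> outer \<Longrightarrow> K \<subseteq> {..<n} \<Longrightarrow> val u \<in> K \<rightarrow> carrier F"
  using val_in by auto

lemma val_eq_if_ent_eq:
  assumes "u \<in> outer" "v \<in> outer" "u < m \<longleftrightarrow> v < m" "k < n" "k' < n"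
    "ent u (m + k) = ent v (m + k')"
  shows "val u k = val v k'"
proof (cases "u < m")
  case True
  then show ?thesis
    using assms conformal by (simp add: ent_def entry_at_def val_def)
next
  case False
  then have "m + n \<le> u" "u < m + n + l" "m + n \<le> v" "v < m + n + l" "\<not> v < m"
    using assms(1-3) unfolding outer_def by auto
  then show ?thesis
    using assms(4-6) False by (simp add: ent_def entry_at_def val_def)
qed

lemma ent_sym: "ent u v = ent v u"
  by (simp add: ent_def entry_at_sym)

lemma colours: "finite colours" "colours \<noteq> {}" "ent u v \<in> colours"
  "card colours = Suc (card (carrier F)) ^ 2"
proof -
  show "finite colours" "colours \<noteq> {}" using fin_F by (auto simp: colours_def)
  show "ent u v \<in> colours"
    using entry_at_in[of A 0 u v] entry_at_in[of B m u v] A_in B_in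
    unfolding colours_def ent_def by blast
  have "card (insert None (Some ` carrier F)) = Suc (card (carrier F))"
    using fin_F by (simp add: card_image)
  then show "card colours = Suc (card (carrier F)) ^ 2"
    unfolding colours_def card_cartesian_product power2_eq_square by simp
qed

abbreviation "division \<equiv> \<lambda>b nb k h. few_rows_division V ent b nb k h colours"

lemma keyD:
  assumes "key h b u = key h b v"
  shows "u < m \<longleftrightarrow> v < m" "block_key V ent h b u = block_key V ent h b v"
    "finsum F (val u) {k \<in> {..<n}. block_key V ent h b (m + k) = y} =
     finsum F (val v) {k \<in> {..<n}. block_key V ent h b (m + k) = y}"
proof -
  show "u < m \<longleftrightarrow> v < m" "block_key V ent h b u = block_key V ent h b v"
    using assms unfolding key_def prod.inject by blast+
  have "snd (snd (key h b u)) y = snd (snd (key h b v)) y" using assms by simp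
  then show "finsum F (val u) {k \<in> {..<n}. block_key V ent h b (m + k) = y} =
     finsum F (val v) {k \<in> {..<n}. block_key V ent h b (m + k) = y}"
    unfolding key_def by simp
qed

text \<open>A coarse class of inner indices is a disjoint union of fine ones, so its sum is
  determined by the fine sums.\<close>

lemma key_coarsen:
  assumes "\<And>u v. u \<in> V \<Longrightarrow> v \<in> V \<Longrightarrow> b u = b v \<Longrightarrow> b' u = b' v"
    "u \<in> outer" "v \<in> outer" "key h b u = key h b v"
  shows "key h b' u = key h b' v"
proof -
  have uv: "u \<in> V" "v \<in> V" using assms(2,3) outer_subset by auto
  let ?k = "block_key V ent h b" and ?k' = "block_key V ent h b'"
  note eq = keyD[OF assms(4)]
  have coarse: "?k' x = ?k' y" if "x \<in> V" "y \<in> V" "?k x = ?k y" for x y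
    using block_key_coarsen[of V b b' x y ent h] assms(1) that by blast
  have "finsum F (val u) {k \<in> {..<n}. ?k' (m + k) = z} = finsum F (val v) {k \<in> {..<n}. ?k' (m + k) = z}" for z
  proof (rule finsum_eq_if_fibre_sums_eq[where \<kappa> = "\<lambda>k. ?k (m + k)"])
    fix y
    let ?Z = "{k \<in> {..<n}. ?k' (m + k) = z}"
    show "finsum F (val u) {k \<in> ?Z. ?k (m + k) = y} = finsum F (val v) {k \<in> ?Z. ?k (m + k) = y}"
    proof (cases "{k \<in> ?Z. ?k (m + k) = y} = {}")
      case False
      then obtain k0 where k0: "k0 < n" "?k' (m + k0) = z" "?k (m + k0) = y" by auto
      have "?k' (m + k) = z" if "k < n" "?k (m + k) = y" for k
        using coarse[of "m + k" "m + k0"] k0 that by simp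
      then have "{k \<in> ?Z. ?k (m + k) = y} = {k \<in> {..<n}. ?k (m + k) = y}" by auto
      then show ?thesis using eq(3)[of y] by simp
    next
      case True
      show ?thesis unfolding True by simp
    qed
  qed (use assms(2,3) val_fun in auto)
  then show ?thesis unfolding key_def using coarse[OF uv eq(2)] eq(1) by simp
qed

text \<open>On an inner class in a simple cell the values of \<open>u\<close>, and so their sum, are
  determined by the type of \<open>u\<close>. Only the sums over the classes in \<open>Y\<close>,
  those in complex cells, have to be recorded.\<close>

lemma card_keys_in_block_le:
  assumes "division b nb k h"
  shows "card (key h b ` {u \<in> outer. b u = a}) \<le> key_bound k h (card (carrier F))"
proof -
  interpret few_rows_division V ent b nb k h colours by (rule assms)
  let ?bk = "block_key V ent h b" and ?c = "complex_blocks V ent h b a"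
  let ?t = "k * h ^ k" and ?q = "card (carrier F)"
  define Y where "Y = {y \<in> (\<lambda>k. ?bk (m + k)) ` {..<n}. ?c (fst y)}"
  have finY: "finite Y" unfolding Y_def by simp
  have "Y \<subseteq> (\<Union>c\<in>{c. ?c c}. ?bk ` {v \<in> V. b v = c})"
    unfolding Y_def by (auto simp: block_key_def)
  then have "card Y \<le> card (\<Union>c\<in>{c. ?c c}. ?bk ` {v \<in> V. b v = c})"
    using finite_complex[of a] by (intro card_mono) auto
  also have "\<dots> \<le> card {c. ?c c} * ?t"
    by (rule card_UN_le_mult[OF finite_complex]) (rule card_block_keys_le)
  also have "\<dots> \<le> k * ?t" by (rule mult_le_mono1[OF card_complex_le])
  finally have cY: "card Y \<le> k * ?t" .
  have q_pos: "0 < ?q" using fin_F zero_closed card_gt_0_iff by blast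
  define g where "g u = (?bk u, \<lambda>y\<in>Y. finsum F (val u) {k \<in> {..<n}. ?bk (m + k) = y})" for u
  have side: "card (key h b ` {u \<in> outer. b u = a \<and> (u < m) = s}) \<le> ?t * ?q ^ (k * ?t)" for s
  proof -
    let ?U = "{u \<in> outer. b u = a \<and> (u < m) = s}"
    have fin: "finite ?U" unfolding outer_def by simp
    have "card (key h b ` ?U) \<le> card (g ` ?U)"
    proof (rule card_image_le_if_determined)
      fix u v assume uv: "u \<in> ?U" "v \<in> ?U" and "g u = g v"
      then have bk: "?bk u = ?bk v"
        and sums: "(\<lambda>y\<in>Y. finsum F (val u) {k \<in> {..<n}. ?bk (m + k) = y}) =
          (\<lambda>y\<in>Y. finsum F (val v) {k \<in> {..<n}. ?bk (m + k) = y})"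
        by (simp_all add: g_def)
      have "finsum F (val u) {k \<in> {..<n}. ?bk (m + k) = y} =
        finsum F (val v) {k \<in> {..<n}. ?bk (m + k) = y}" for y
      proof (cases "y \<in> Y")
        case True
        then show ?thesis using fun_cong[OF sums, of y] by simp
      next
        case False
        show ?thesis
        proof (rule finsum_cong')
          fix k assume "k \<in> {k \<in> {..<n}. ?bk (m + k) = y}"
          then have k: "k < n" "?bk (m + k) = y" by auto
          then have "y \<in> (\<lambda>k. ?bk (m + k)) ` {..<n}" by blast
          moreover have "fst y = b (m + k)" using k(2) by (auto simp: block_key_def)
          ultimately have "\<not> ?c (b (m + k))" using False unfolding Y_def by auto
          then have "ent u (m + k) = ent v (m + k)"
            using block_keyD(2)[OF bk, of "m + k"] uv k(1) by simp
          then show "val u k = val v k"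
            using val_eq_if_ent_eq[of u v k k] uv k(1) by auto
        qed (use uv val_fun in auto)
      qed
      then show "key h b u = key h b v" unfolding key_def using bk uv by auto
    qed (use fin in simp)
    also have "\<dots> \<le> card (?bk ` {v \<in> V. b v = a} \<times> (Y \<rightarrow>\<^sub>E carrier F))"
    proof (rule card_mono)
      show "finite (?bk ` {v \<in> V. b v = a} \<times> (Y \<rightarrow>\<^sub>E carrier F))"
        using finY fin_F by (intro finite_cartesian_product finite_PiE) auto
      have "finsum F (val u) {k \<in> {..<n}. ?bk (m + k) = y} \<in> carrier F" if "u \<in> outer" for u y
        using val_fun[OF that] by (intro finsum_closed) auto
      then show "g ` ?U \<subseteq> ?bk ` {v \<in> V. b v = a} \<times> (Y \<rightarrow>\<^sub>E carrier F)"
        using outer_subset by (auto simp: g_def)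
    qed
    also have "\<dots> = card (?bk ` {v \<in> V. b v = a}) * ?q ^ card Y"
      using finY by (simp add: card_cartesian_product card_PiE)
    also have "\<dots> \<le> ?t * ?q ^ (k * ?t)"
      using q_pos cY by (intro mult_le_mono card_block_keys_le power_increasing) auto
    finally show ?thesis .
  qed
  have "{u \<in> outer. b u = a} = {u \<in> outer. b u = a \<and> (u < m) = True} \<union> {u \<in> outer. b u = a \<and> (u < m) = False}"
    by auto
  then have "card (key h b ` {u \<in> outer. b u = a}) \<le>
      card (key h b ` {u \<in> outer. b u = a \<and> (u < m) = True}) +
      card (key h b ` {u \<in> outer. b u = a \<and> (u < m) = False})"
    by (metis (no_types, lifting) card_Un_le image_Un)
  then show ?thesis using side[of True] side[of False] unfolding key_bound_def by linarith
qed

text \<open>The product entry is a sum over the classes of inner indices. On each class at least one of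
  the two factors is constant, since its cell is not complex.\<close>

lemma product_eq_if_key_eq:
  assumes r: "r < m" "r' < m" "key h b r = key h b r'"
    and c: "c < l" "c' < l" "key h b (m + n + c) = key h b (m + n + c')"
    and sep: "\<And>k. k < n \<Longrightarrow> \<not> (complex_blocks V ent h b (b r) (b (m + k)) \<and>
      complex_blocks V ent h b (b (m + k)) (b (m + n + c)))"
  shows "AB $$ (r, c) = AB $$ (r', c')"
proof -
  let ?bk = "block_key V ent h b" and ?cx = "complex_blocks V ent h b"
  let ?c = "m + n + c" and ?c' = "m + n + c'"
  have out: "r \<in> outer" "r' \<in> outer" "?c \<in> outer" "?c' \<in> outer" using r c by (auto simp: outer_def)
  note V = out[THEN subsetD[OF outer_subset]]
  note rr = keyD(2,3)[OF r(3)] and cc = keyD(2,3)[OF c(3)]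
  have val_cong: "val u k = val u k'"
    if "u \<in> outer" "k < n" "k' < n" "?bk (m + k) = ?bk (m + k')" "\<not> ?cx (b (m + k)) (b u)" for u k k'
  proof -
    have "ent (m + k) u = ent (m + k') u"
      using block_keyD(2)[OF that(4), of u] that(1,5) outer_subset by blast
    then show ?thesis
      using val_eq_if_ent_eq[of u u k k'] that ent_sym by metis
  qed
  have val_cong2: "val u k = val v k"
    if "u \<in> outer" "v \<in> outer" "u < m \<longleftrightarrow> v < m" "k < n" "?bk u = ?bk v" "\<not> ?cx (b u) (b (m + k))" for u v k
    using block_keyD(2)[OF that(5), of "m + k"] that val_eq_if_ent_eq[of u v k k] by simp
  have entry: "AB $$ (i, j) = finsum F (\<lambda>k. val i k \<otimes> val (m + n + j) k) {..<n}"
    if "i < m" "j < l" for i j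
    using that conformal unfolding mat_mult_over_def val_def by simp
  have "finsum F (\<lambda>k. val r k \<otimes> val ?c k) {..<n} = finsum F (\<lambda>k. val r' k \<otimes> val ?c' k) {..<n}"
  proof (rule finsum_eq_if_fibre_sums_eq[where \<kappa> = "\<lambda>k. ?bk (m + k)"])
    fix y
    let ?Z = "{k \<in> {..<n}. ?bk (m + k) = y}"
    have Z: "finite ?Z" "?Z \<subseteq> {..<n}" by auto
    show "finsum F (\<lambda>k. val r k \<otimes> val ?c k) ?Z = finsum F (\<lambda>k. val r' k \<otimes> val ?c' k) ?Z"
    proof (cases "?Z = {}")
      case False
      then obtain k0 where k0: "k0 < n" "?bk (m + k0) = y" by auto
      have bk0: "b (m + k) = b (m + k0)" if "k \<in> ?Z" for k
        using block_keyD(1)[of V ent h b "m + k" "m + k0"] that k0 by simp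
      consider "\<not> ?cx (b r) (b (m + k0))" | "\<not> ?cx (b (m + k0)) (b ?c)" using sep[OF k0(1)] by blast
      then show ?thesis
      proof cases
        case 1
        \<comment> \<open>By symmetry, inner indices of equal type have the same entry with
          \<open>r\<close>; equality of the types of \<open>r\<close> and \<open>r'\<close> carries
          the value over to \<open>r'\<close>. The remaining column sums agree by the keys.\<close>
        define \<alpha> where "\<alpha> = val r k0"
        have \<alpha>: "\<alpha> \<in> carrier F" unfolding \<alpha>_def using val_in out k0(1) by blast
        have "val r k = \<alpha> \<and> val r' k = \<alpha>" if k: "k \<in> ?Z" for k
        proof -
          have "val r k = val r' k"
            using val_cong2[OF out(1,2) _ _ rr(1)] 1 bk0[OF k] k r by simp
          moreover have "val r k = \<alpha>"
            unfolding \<alpha>_def using val_cong[OF out(1), of k k0] 1 bk0[OF k] k k0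
            by (simp add: complex_blocks_sym)
          ultimately show ?thesis by simp
        qed
        then have "finsum F (\<lambda>k. val r k \<otimes> val ?c k) ?Z = finsum F (\<lambda>k. \<alpha> \<otimes> val ?c k) ?Z"
          "finsum F (\<lambda>k. val r' k \<otimes> val ?c' k) ?Z = finsum F (\<lambda>k. \<alpha> \<otimes> val ?c' k) ?Z"
          using \<alpha> val_fun[OF out(3) Z(2)] val_fun[OF out(4) Z(2)]
          by (auto intro!: finsum_cong')
        moreover have "finsum F (\<lambda>k. \<alpha> \<otimes> val ?c k) ?Z = \<alpha> \<otimes> finsum F (val ?c) ?Z"
          "finsum F (\<lambda>k. \<alpha> \<otimes> val ?c' k) ?Z = \<alpha> \<otimes> finsum F (val ?c') ?Z"
          using finsum_rdistr[OF Z(1) \<alpha> val_fun[OF out(3) Z(2)]]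
            finsum_rdistr[OF Z(1) \<alpha> val_fun[OF out(4) Z(2)]] by simp_all
        ultimately show ?thesis using cc(2)[of y] by simp
      next
        case 2
        define \<beta> where "\<beta> = val ?c k0"
        have \<beta>: "\<beta> \<in> carrier F" unfolding \<beta>_def using val_in out k0(1) by blast
        have "val ?c k = \<beta> \<and> val ?c' k = \<beta>" if k: "k \<in> ?Z" for k
        proof -
          have "val ?c k = val ?c' k"
            using val_cong2[OF out(3,4) _ _ cc(1)] 2 bk0[OF k] k
            by (simp add: complex_blocks_sym)
          moreover have "val ?c k = \<beta>"
            unfolding \<beta>_def using val_cong[OF out(3), of k k0] 2 bk0[OF k] k k0 by simp
          ultimately show ?thesis by simp
        qed
        then have "finsum F (\<lambda>k. val r k \<otimes> val ?c k) ?Z = finsum F (\<lambda>k. val r k \<otimes> \<beta>) ?Z"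
          "finsum F (\<lambda>k. val r' k \<otimes> val ?c' k) ?Z = finsum F (\<lambda>k. val r' k \<otimes> \<beta>) ?Z"
          using \<beta> val_fun[OF out(1) Z(2)] val_fun[OF out(2) Z(2)]
          by (auto intro!: finsum_cong')
        moreover have "finsum F (\<lambda>k. val r k \<otimes> \<beta>) ?Z = finsum F (val r) ?Z \<otimes> \<beta>"
          "finsum F (\<lambda>k. val r' k \<otimes> \<beta>) ?Z = finsum F (val r') ?Z \<otimes> \<beta>"
          using finsum_ldistr[OF Z(1) \<beta> val_fun[OF out(1) Z(2)]]
            finsum_ldistr[OF Z(1) \<beta> val_fun[OF out(2) Z(2)]] by simp_all
        ultimately show ?thesis using rr(2)[of y] by simp
      qed
    next
      case True
      show ?thesis unfolding True by simp
    qed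
  qed (use out val_in in auto)
  then show ?thesis using entry[OF r(1) c(1)] entry[OF r(2) c(2)] by simp
qed

section \<open>Red degrees of the partition by keys\<close>

abbreviation "S \<equiv> mat_structure AB"
abbreviation "U \<equiv> row_col_set AB"

definition key_partition where
  "key_partition h b = fibres (\<lambda>x. key h b (pos x)) U"

lemma dim_AB: "dim_row AB = m" "dim_col AB = l"
  by (simp_all add: mat_mult_over_def)

lemma U_cases:
  assumes "x \<in> U"
  obtains i where "x = Inl i" "i < m" "pos x = i" | j where "x = Inr j" "j < l" "pos x = m + n + j"
  using assms by (auto simp: row_col_set_def dim_AB pos_def)

lemma pos_in_outer: "x \<in> U \<Longrightarrow> pos x \<in> outer"
  by (auto simp: row_col_set_def dim_AB pos_def outer_def)

lemma pos_in_V: "x \<in> U \<Longrightarrow> pos x \<in> V"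
  using pos_in_outer outer_subset by blast

lemma inj_on_pos: "inj_on pos U"
  by (auto simp: inj_on_def row_col_set_def dim_AB pos_def)

lemma row_col_le_pos: "x \<in> U \<Longrightarrow> y \<in> U \<Longrightarrow> row_col_le x y \<longleftrightarrow> pos x \<le> pos y"
  by (auto simp: row_col_set_def dim_AB pos_def)

lemma finite_U: "finite U"
  by (rule finite_row_col_set)

lemma card_parts_in_blocks_le:
  assumes "division b nb k h" "finite C"
  shows "card {X \<in> key_partition h b. X \<subseteq> {x \<in> U. b (pos x) \<in> C}}
    \<le> card C * key_bound k h (card (carrier F))"
proof -
  let ?Z = "{x \<in> U. b (pos x) \<in> C}"
  have "card {X \<in> key_partition h b. X \<subseteq> ?Z} \<le> card ((\<lambda>x. key h b (pos x)) ` ?Z)"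
    unfolding key_partition_def using finite_U by (intro card_fibres_within_le) simp
  also have "\<dots> \<le> card (\<Union>c\<in>C. key h b ` {u \<in> outer. b u = c})"
  proof (rule card_mono)
    have "finite outer" unfolding outer_def by simp
    then show "finite (\<Union>c\<in>C. key h b ` {u \<in> outer. b u = c})" using assms(2) by simp
  qed (use pos_in_outer in auto)
  also have "\<dots> \<le> card C * key_bound k h (card (carrier F))"
    by (rule card_UN_le_mult[OF assms(2) card_keys_in_block_le[OF assms(1)]])
  finally show ?thesis .
qed

text \<open>Blocks are intervals, so for different blocks the order is read off the block numbers.
  The keys fix the side, and without a common complex block they fix the product entry too.\<close>

lemma atomic_type_eq_if_separated:
  assumes b: "mono_on V b"
    and U: "u \<in> U" "u' \<in> U" "v \<in> U" "v' \<in> U"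
    and keys: "key h b (pos u) = key h b (pos u')" "key h b (pos v) = key h b (pos v')"
    and ne: "b (pos u) \<noteq> b (pos v)"
    and sep: "\<And>c. \<not> (complex_blocks V ent h b (b (pos u)) c \<and> complex_blocks V ent h b c (b (pos v)))"
  shows "atomic_type S u v = atomic_type S u' v'"
proof -
  have bmono: "b x \<le> b y" if "x \<in> V" "y \<in> V" "x \<le> y" for x y
    using b that by (auto simp: mono_on_def)
  have bu: "b (pos u) = b (pos u')" and bv: "b (pos v) = b (pos v')"
    using block_keyD(1)[OF keyD(2)[OF keys(1)]] block_keyD(1)[OF keyD(2)[OF keys(2)]] by simp_all
  have row: "x \<in> Inl ` {..<dim_row AB} \<longleftrightarrow> pos x < m" if "x \<in> U" for x
    by (rule U_cases[OF that]) (auto simp: dim_AB)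
  have le_iff: "row_col_le x y \<longleftrightarrow> b (pos x) < b (pos y)" if "x \<in> U" "y \<in> U" "b (pos x) \<noteq> b (pos y)" for x y
    using bmono[of "pos x" "pos y"] bmono[of "pos y" "pos x"] that pos_in_V row_col_le_pos[OF that(1,2)]
    by (metis linorder_not_le nat_less_le nle_le)
  have entries: "AB $$ (i, j) = AB $$ (i', j')"
    if x: "x = Inl i" "x' = Inl i'" "y = Inr j" "y' = Inr j'" "x \<in> U" "x' \<in> U" "y \<in> U" "y' \<in> U"
      "key h b (pos x) = key h b (pos x')" "key h b (pos y) = key h b (pos y')"
      "\<And>c. \<not> (complex_blocks V ent h b (b (pos x)) c \<and> complex_blocks V ent h b c (b (pos y)))"
    for x x' y y' i i' j j'
  proof (rule product_eq_if_key_eq)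
    show "i < m" "i' < m" "j < l" "j' < l"
      using x(5-8) unfolding x(1-4) by (auto simp: row_col_set_def dim_AB)
    show "key h b i = key h b i'" "key h b (m + n + j) = key h b (m + n + j')"
      using x(9,10) unfolding x(1-4) by (simp_all add: pos_def)
    show "\<not> (complex_blocks V ent h b (b i) (b (m + k)) \<and>
      complex_blocks V ent h b (b (m + k)) (b (m + n + j)))" for k
      using x(11)[of "b (m + k)"] unfolding x(1,3) by (simp add: pos_def)
  qed
  have side: "(\<exists>i. x = Inl i) \<longleftrightarrow> (\<exists>i. x' = Inl i)"
    if "x \<in> U" "x' \<in> U" "key h b (pos x) = key h b (pos x')" for x x'
    using keyD(1)[OF that(3)] by (rule_tac U_cases[OF that(1)]; rule_tac U_cases[OF that(2)]) auto
  have entry_iff: "(x, y) \<in> binary_rel S (Entry a) \<longleftrightarrow> (x', y') \<in> binary_rel S (Entry a)"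
    if x: "x \<in> U" "x' \<in> U" "y \<in> U" "y' \<in> U"
      "key h b (pos x) = key h b (pos x')" "key h b (pos y) = key h b (pos y')"
      "\<And>c. \<not> (complex_blocks V ent h b (b (pos x)) c \<and> complex_blocks V ent h b c (b (pos y)))"
    for x x' y y' a
  proof (cases "(\<exists>i. x = Inl i) \<and> \<not> (\<exists>i. y = Inl i)")
    case True
    then have "\<not> (\<exists>i. y' = Inl i)" "\<exists>i. x' = Inl i" using side[OF x(1,2,5)] side[OF x(3,4,6)] by auto
    with True obtain i i' j j' where ij: "x = Inl i" "x' = Inl i'" "y = Inr j" "y' = Inr j'"
      by (metis sum.exhaust)
    have "i < m" "i' < m" "j < l" "j' < l"
      using x(1-4) unfolding ij by (auto simp: row_col_set_def dim_AB)
    then show ?thesis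
      using entries[OF ij x] unfolding mat_structure_rels dim_AB ij by simp
  next
    case False
    then have "\<not> ((\<exists>i. x' = Inl i) \<and> \<not> (\<exists>i. y' = Inl i))"
      using side[OF x(1,2,5)] side[OF x(3,4,6)] by auto
    then show ?thesis using False unfolding mat_structure_rels by auto
  qed
  have unary: "{P. u \<in> unary_rel S P} = {P. u' \<in> unary_rel S P}" "{P. v \<in> unary_rel S P} = {P. v' \<in> unary_rel S P}"
    unfolding mat_structure_rels row[OF U(1)] row[OF U(2)] row[OF U(3)] row[OF U(4)]
      keyD(1)[OF keys(1)] keyD(1)[OF keys(2)] by simp_all
  have "(u, v) \<in> binary_rel S E \<longleftrightarrow> (u', v') \<in> binary_rel S E" for E
  proof (cases E)
    case Leq
    then show ?thesis
      using le_iff[OF U(1,3)] le_iff[OF U(2,4)] ne bu bv U unfolding mat_structure_rels Leq by simp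
  next
    case (Entry a)
    then show ?thesis using entry_iff[OF U keys sep] by simp
  qed
  moreover have "(v, u) \<in> binary_rel S E \<longleftrightarrow> (v', u') \<in> binary_rel S E" for E
  proof (cases E)
    case Leq
    then show ?thesis
      using le_iff[OF U(3,1)] le_iff[OF U(4,2)] ne bu bv U unfolding mat_structure_rels Leq by simp
  next
    case (Entry a)
    have "\<not> (complex_blocks V ent h b (b (pos v)) c \<and> complex_blocks V ent h b c (b (pos u)))" for c
      using sep[of c] complex_blocks_sym[of V ent h b] by blast
    then show ?thesis using entry_iff[OF U(3,4,1,2) keys(2,1)] Entry by simp
  qed
  ultimately show ?thesis unfolding atomic_type_def unary by simp
qed

text \<open>Red neighbours lie in the same block, where the order is undetermined, or two steps away
  in the complexity relation: at most \<open>1 + k * k\<close> blocks.\<close>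

lemma card_red_key_partition_le:
  assumes "division b nb k h" "mono_on V b" "Z \<in> key_partition h b"
  shows "card {Z' \<in> key_partition h b. red_adjacent S Z Z'}
    \<le> Suc (k * k) * key_bound k h (card (carrier F))"
proof -
  interpret few_rows_division V ent b nb k h colours by (rule assms)
  let ?cx = "complex_blocks V ent h b"
  obtain x where x: "x \<in> U" "Z = {y \<in> U. key h b (pos y) = key h b (pos x)}"
    using assms(3) unfolding key_partition_def fibres_def by blast
  let ?a = "b (pos x)"
  define C where "C = insert ?a (\<Union>c\<in>{c. ?cx ?a c}. {e. ?cx c e})"
  have finC: "finite C" unfolding C_def using finite_complex by auto
  have "card C \<le> Suc (card (\<Union>c\<in>{c. ?cx ?a c}. {e. ?cx c e}))"
    unfolding C_def using finite_complex by (simp add: card_insert_if)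
  also have "card (\<Union>c\<in>{c. ?cx ?a c}. {e. ?cx c e}) \<le> card {c. ?cx ?a c} * k"
    by (rule card_UN_le_mult[OF finite_complex card_complex_le])
  also have "\<dots> \<le> k * k" by (rule mult_le_mono1[OF card_complex_le])
  finally have cC: "card C \<le> Suc (k * k)" by simp
  have sub: "{Z' \<in> key_partition h b. red_adjacent S Z Z'} \<subseteq>
      {X \<in> key_partition h b. X \<subseteq> {x \<in> U. b (pos x) \<in> C}}"
  proof
    fix Z' assume Z': "Z' \<in> {Z' \<in> key_partition h b. red_adjacent S Z Z'}"
    then obtain y where y: "y \<in> U" "Z' = {z \<in> U. key h b (pos z) = key h b (pos y)}"
      unfolding key_partition_def fibres_def by blast
    have same: "b (pos z) = b (pos y)" if "z \<in> Z'" for z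
      using that block_keyD(1)[OF keyD(2)] unfolding y(2) by blast
    have "b (pos y) \<in> C"
    proof (rule ccontr)
      assume "b (pos y) \<notin> C"
      then have notC: "?a \<noteq> b (pos y)" "\<And>c. \<not> (?cx ?a c \<and> ?cx c (b (pos y)))"
        unfolding C_def by auto
      obtain u u' v v' where uv: "u \<in> Z" "u' \<in> Z" "v \<in> Z'" "v' \<in> Z'"
        "atomic_type S u v \<noteq> atomic_type S u' v'"
        using Z' unfolding red_adjacent_def by blast
      have U: "u \<in> U" "u' \<in> U" "v \<in> U" "v' \<in> U"
        and keys: "key h b (pos u) = key h b (pos u')" "key h b (pos v) = key h b (pos v')"
        and ux: "key h b (pos u) = key h b (pos x)"
        using uv(1-4) unfolding x(2) y(2) by simp_all
      have bu: "b (pos u) = ?a" by (rule block_keyD(1)[OF keyD(2)[OF ux]])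
      have "atomic_type S u v = atomic_type S u' v'"
        by (rule atomic_type_eq_if_separated[OF assms(2) U keys])
          (use notC in \<open>simp_all only: bu same[OF uv(3)] not_False_eq_True\<close>)
      then show False using uv(5) by simp
    qed
    then have "Z' \<subseteq> {x \<in> U. b (pos x) \<in> C}" using same y(2) by auto
    then show "Z' \<in> {X \<in> key_partition h b. X \<subseteq> {x \<in> U. b (pos x) \<in> C}}" using Z' by blast
  qed
  have "finite (key_partition h b)" unfolding key_partition_def fibres_def using finite_U by simp
  then have "card {Z' \<in> key_partition h b. red_adjacent S Z Z'} \<le>
      card {X \<in> key_partition h b. X \<subseteq> {x \<in> U. b (pos x) \<in> C}}"
    using sub by (intro card_mono) auto
  also have "\<dots> \<le> card C * key_bound k h (card (carrier F))"
    by (rule card_parts_in_blocks_le[OF assms(1) finC])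
  also have "\<dots> \<le> Suc (k * k) * key_bound k h (card (carrier F))" by (rule mult_le_mono1[OF cC])
  finally show ?thesis .
qed

text \<open>A new part extends over at most two old blocks and so contains at most twice
  \<open>key_bound\<close> old parts.\<close>

lemma reachable_merge:
  assumes "division b nb k h" "division (\<lambda>v. merge_at c (b v)) nb' k h" "mono_on V b"
    and r: "reachable S d (key_partition h b)"
    and d: "Suc (Suc (k * k) * key_bound k h (card (carrier F))) * (2 * key_bound k h (card (carrier F))) \<le> d"
  shows "reachable S d (key_partition h (\<lambda>v. merge_at c (b v)))" "mono_on V (\<lambda>v. merge_at c (b v))"
proof -
  let ?b = "\<lambda>v. merge_at c (b v)"
  have "merge_at c x \<le> merge_at c y" if "x \<le> y" for x y using that by (auto simp: merge_at_def)
  then show mono: "mono_on V ?b" using assms(3) unfolding mono_on_def by blast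
  show "reachable S d (key_partition h ?b)"
  proof (rule reachable_coarsen[OF r _ _ _ _ d])
    show "refines (universe S) (key_partition h b) (key_partition h ?b)"
      unfolding key_partition_def universe_mat_structure
    proof (rule refines_fibres)
      fix x y assume "x \<in> U" "y \<in> U" "key h b (pos x) = key h b (pos y)"
      then show "key h ?b (pos x) = key h ?b (pos y)"
        by (intro key_coarsen[of b ?b]) (auto intro: pos_in_outer)
    qed
    fix Z assume Z: "Z \<in> key_partition h ?b"
    show "card {Z' \<in> key_partition h ?b. red_adjacent S Z Z'} \<le> Suc (k * k) * key_bound k h (card (carrier F))"
      by (rule card_red_key_partition_le[OF assms(2) mono Z])
    obtain x where x: "x \<in> U" "Z = {y \<in> U. key h ?b (pos y) = key h ?b (pos x)}"
      using Z unfolding key_partition_def fibres_def by blast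
    \<comment> \<open>\<open>merge_at\<close> lowers a number by at most one, so these are the only
      possible old numbers.\<close>
    let ?C = "{?b (pos x), Suc (?b (pos x))}"
    have "Z \<subseteq> {x \<in> U. b (pos x) \<in> ?C}"
    proof
      fix y assume "y \<in> Z"
      then have y: "y \<in> U" "key h ?b (pos y) = key h ?b (pos x)" unfolding x(2) by simp_all
      have "?b (pos y) = ?b (pos x)" by (rule block_keyD(1)[OF keyD(2)[OF y(2)]])
      then have "b (pos y) \<in> ?C" by (auto simp: merge_at_def split: if_splits)
      then show "y \<in> {x \<in> U. b (pos x) \<in> ?C}" using y(1) by simp
    qed
    moreover have "finite (key_partition h b)" unfolding key_partition_def fibres_def using finite_U by simp
    ultimately have "card {X \<in> key_partition h b. X \<subseteq> Z} \<le>
        card {X \<in> key_partition h b. X \<subseteq> {x \<in> U. b (pos x) \<in> ?C}}"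
      by (intro card_mono) auto
    also have "\<dots> \<le> card ?C * key_bound k h (card (carrier F))"
      by (rule card_parts_in_blocks_le[OF assms(1)]) simp
    also have "\<dots> = 2 * key_bound k h (card (carrier F))" by simp
    finally show "card {X \<in> key_partition h b. X \<subseteq> Z} \<le> 2 * key_bound k h (card (carrier F))" .
  qed (simp add: finite_U)
qed

definition few_bound :: nat where
  "few_bound = Suc (row_bound (Suc (tww A)) (Suc (card (carrier F)))) *
    Suc (row_bound (Suc (tww B)) (Suc (card (carrier F))))"

lemma finite_span: "finite (span M off)"
  by (simp add: span_def)

text \<open>A block that fails for the pair of matrices fails for one of them; two eighths make a
  quarter.\<close>

lemma card_blocks_without_few_rows_ent:
  assumes b: "mono_on V b" "\<And>v. v \<in> V \<Longrightarrow> b v < N"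
  shows "4 * card {a. a < N \<and> \<not> few_rows_outside V ent b few_bound a} \<le> N"
proof -
  let ?ka = "row_bound (Suc (tww A)) (Suc (card (carrier F)))"
  let ?kb = "row_bound (Suc (tww B)) (Suc (card (carrier F)))"
  let ?Va = "span A 0" and ?Vb = "span B m"
  let ?Xa = "{a. a < N \<and> \<not> few_rows_outside ?Va (entry_at A 0) b ?ka a}"
  let ?Xb = "{a. a < N \<and> \<not> few_rows_outside ?Vb (entry_at B m) b ?kb a}"
  have V: "V = ?Va \<union> ?Vb" using conformal by (auto simp: span_def)
  have "8 * card ?Xa \<le> N"
    by (rule card_blocks_without_few_rows_mat[OF fin_F A_in])
      (use V b in \<open>auto intro: mono_on_subset\<close>)
  moreover have "8 * card ?Xb \<le> N"
    by (rule card_blocks_without_few_rows_mat[OF fin_F B_in])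
      (use V b in \<open>auto intro: mono_on_subset\<close>)
  moreover have "{a. a < N \<and> \<not> few_rows_outside V ent b few_bound a} \<subseteq> ?Xa \<union> ?Xb"
  proof (rule subsetI, rule ccontr)
    fix a assume a: "a \<in> {a. a < N \<and> \<not> few_rows_outside V ent b few_bound a}" "a \<notin> ?Xa \<union> ?Xb"
    have "few_rows_outside (?Va \<union> ?Vb) (\<lambda>u v. (entry_at A 0 u v, entry_at B m u v)) b few_bound a"
      unfolding few_bound_def
    proof (rule few_rows_outside_Pair)
      show "few_rows_outside ?Va (entry_at A 0) b ?ka a" "few_rows_outside ?Vb (entry_at B m) b ?kb a"
        using a by auto
    qed (auto simp: entry_at_outside finite_span)
    then show False using a(1) unfolding V ent_def by simp
  qed
  then have "card {a. a < N \<and> \<not> few_rows_outside V ent b few_bound a} \<le> card (?Xa \<union> ?Xb)"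
    by (intro card_mono) auto
  then have "card {a. a < N \<and> \<not> few_rows_outside V ent b few_bound a} \<le> card ?Xa + card ?Xb"
    using card_Un_le[of ?Xa ?Xb] by linarith
  ultimately show ?thesis by linarith
qed

end

text \<open>Here \<open>k\<close> is twice \<open>few_bound\<close>, since undoing the pairing
  doubles it, and \<open>Suc q ^ 2\<close> is the number of colours. The last line is the
  requirement of \<open>reachable_coarsen\<close> with red degree \<open>Suc (k * k) * t\<close> and
  \<open>2 * t\<close> old parts per new part.\<close>

definition product_bound :: "nat \<Rightarrow> nat \<Rightarrow> nat \<Rightarrow> nat" where
  "product_bound x y q =
    (let k = 2 * (Suc (row_bound (Suc x) (Suc q)) * Suc (row_bound (Suc y) (Suc q)));
         t = key_bound k (k + (Suc q ^ 2) ^ k) q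
     in Suc (Suc (k * k) * t) * (2 * t))"

context conformal_matrices
begin

text \<open>Induction on the number of merges, from singleton blocks to a single block, with the
  same \<open>k\<close> throughout; \<open>reachable_merge\<close> links consecutive
  divisions.\<close>

lemma tww_product_le: "tww AB \<le> product_bound (tww A) (tww B) (card (carrier F))"
proof -
  define k where "k = 2 * few_bound"
  define h where "h = k + card colours ^ k"
  define t where "t = key_bound k h (card (carrier F))"
  define d where "d = Suc (Suc (k * k) * t) * (2 * t)"
  have d_eq: "d = product_bound (tww A) (tww B) (card (carrier F))"
    unfolding d_def t_def h_def k_def colours(4) few_bound_def product_bound_def Let_def ..
  have k_pos: "1 \<le> k" unfolding k_def few_bound_def by simp
  have divisionI: "division b N k h"
    if "\<And>v. v \<in> V \<Longrightarrow> b v < N" "\<And>a. a < N \<Longrightarrow> few_rows_outside V ent b k a" for b N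
    using that colours ent_sym by unfold_locales (auto simp: h_def)
  let ?N = "m + n + l"
  have fin: "finite (universe S)" by (simp add: finite_U)
  have part: "partition_on (universe S) (key_partition h b)" for b
    unfolding key_partition_def universe_mat_structure by (rule partition_on_fibres)
  have merges: "\<exists>b. mono_on V b \<and> (\<forall>v\<in>V. b v < ?N - j) \<and>
      (\<forall>a < ?N - j. few_rows_outside V ent b k a) \<and> reachable S d (key_partition h b)"
    if "j < ?N" for j
    using that
  proof (induction j)
    case 0
    have "few_rows_outside V ent (\<lambda>v. v) k a" for a
    proof -
      have "nrows ent {v \<in> V. v = a} {w \<in> V. w \<notin> {}} \<le> card {v \<in> V. v = a}"
        by (rule nrows_le_card) simp
      also have "\<dots> \<le> card {a}" by (rule card_mono) auto
      finally show ?thesis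
        unfolding few_rows_outside_def using k_pos by (intro exI[of _ "{}"]) simp
    qed
    moreover have "key_partition h (\<lambda>v. v) = (\<lambda>x. {x}) ` universe S"
    proof -
      have "{y \<in> U. key h (\<lambda>v. v) (pos y) = key h (\<lambda>v. v) (pos x)} = {x}" if x: "x \<in> U" for x
      proof -
        have "y = x" if "y \<in> U" "key h (\<lambda>v. v) (pos y) = key h (\<lambda>v. v) (pos x)" for y
          using block_keyD(1)[OF keyD(2)[OF that(2)]] inj_onD[OF inj_on_pos _ that(1) x] by simp
        then show ?thesis using x by auto
      qed
      then show ?thesis unfolding key_partition_def fibres_def universe_mat_structure
        by (intro image_cong) simp_all
    qed
    then have "reachable S d (key_partition h (\<lambda>v. v))"
      using reachable_singletons[of S d] by (simp only:)
    moreover have "mono_on V (\<lambda>v. v)" by (simp add: mono_on_def)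
    ultimately show ?case by (intro exI[of _ "\<lambda>v. v"]) simp
  next
    case (Suc j)
    let ?n = "?N - j"
    have n2: "2 \<le> ?n" using Suc.prems by simp
    obtain b where b: "mono_on V b" "\<And>v. v \<in> V \<Longrightarrow> b v < ?n"
      "\<And>a. a < ?n \<Longrightarrow> few_rows_outside V ent b k a" "reachable S d (key_partition h b)"
      using Suc by auto
    have "4 * card {a. a < (?n + 1) div 2 \<and> \<not> few_rows_outside V ent (\<lambda>v. b v div 2) few_bound a}
        \<le> (?n + 1) div 2"
    proof (rule card_blocks_without_few_rows_ent)
      show "mono_on V (\<lambda>v. b v div 2)" using b(1) by (auto simp: mono_on_def intro!: div_le_mono)
      show "b v div 2 < (?n + 1) div 2" if "v \<in> V" for v using b(2)[OF that] by linarith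
    qed
    then obtain c where c: "Suc c < ?n"
      "\<And>a. a < ?n - 1 \<Longrightarrow> few_rows_outside V ent (\<lambda>v. merge_at c (b v)) k a"
      using ex_merge_keeping_few_rows[of V ?n b ent few_bound] n2 b(2,3) unfolding k_def by auto
    have b': "merge_at c (b v) < ?n - 1" if "v \<in> V" for v
      using b(2)[OF that] c(1) unfolding merge_at_def by auto
    have "reachable S d (key_partition h (\<lambda>v. merge_at c (b v)))" "mono_on V (\<lambda>v. merge_at c (b v))"
      using reachable_merge[OF divisionI[OF b(2,3)] divisionI[OF b' c(2)] b(1,4)]
      unfolding d_def t_def by auto
    moreover have "?N - Suc j = ?n - 1" by simp
    ultimately show ?case using b' c(2) by (intro exI[of _ "\<lambda>v. merge_at c (b v)"]) simp
  qed
  have "twin_width S \<le> d"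
  proof (cases "?N = 0")
    case True
    then have "universe S = {}" by (simp add: row_col_set_def dim_AB)
    then show ?thesis
      by (intro twin_width_le_if_reachable[OF reachable_singletons fin partition_on_singletons]) simp
  next
    case False
    then have N: "?N - 1 < ?N" "?N - (?N - 1) = 1" by auto
    obtain b where b: "\<And>v. v \<in> V \<Longrightarrow> b v < 1" "\<And>a. a < 1 \<Longrightarrow> few_rows_outside V ent b k a"
      "reachable S d (key_partition h b)"
      using merges[OF N(1)] unfolding N(2) by blast
    \<comment> \<open>All remaining parts lie in block 0, so there are at most \<open>t\<close> of
      them, and they can be merged in any order.\<close>
    have "{X \<in> key_partition h b. X \<subseteq> {x \<in> U. b (pos x) \<in> {0}}} = key_partition h b"
      using b(1) pos_in_V unfolding key_partition_def fibres_def by auto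
    then have "card (key_partition h b) \<le> t"
      using card_parts_in_blocks_le[OF divisionI[OF b(1,2)], of "{0}"] unfolding t_def by simp
    also have "t \<le> d" unfolding d_def by simp
    finally show ?thesis by (rule twin_width_le_if_reachable[OF b(3) fin part])
  qed
  then show ?thesis unfolding tww_def d_eq .
qed

end

theorem theorem45:
  shows "\<exists>f :: nat \<Rightarrow> nat \<Rightarrow> nat \<Rightarrow> nat.
    \<forall>(q :: nat) (F :: 'a ring) (A :: 'a mat) (B :: 'a mat).
      primepow q \<longrightarrow> field F \<longrightarrow> card (carrier F) = q \<longrightarrow>
      elements_mat A \<subseteq> carrier F \<longrightarrow> elements_mat B \<subseteq> carrier F \<longrightarrow>
      dim_col A = dim_row B \<longrightarrow>
      tww (mat_mult_over F A B) \<le> f (tww A) (tww B) q"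
proof (intro exI[of _ product_bound] allI impI)
  fix q :: nat and F :: "'a ring" and A B :: "'a mat"
  assume q: "primepow q" "card (carrier F) = q" and F: "field F"
    and AB: "elements_mat A \<subseteq> carrier F" "elements_mat B \<subseteq> carrier F" "dim_col A = dim_row B"
  \<comment> \<open>An infinite carrier would have cardinality 0, which is not a prime
    power.\<close>
  have "finite (carrier F)" using q primepow_gt_0_nat card_ge_0_finite by blast
  then interpret conformal_matrices F A B
    by (intro conformal_matrices.intro F conformal_matrices_axioms.intro AB)
  show "tww (mat_mult_over F A B) \<le> product_bound (tww A) (tww B) q"
    using tww_product_le unfolding q(2) .
qed

end
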